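(* Let $F$ be a function field over a finite field $k$ of odd characteristic, and let $\mathcal{O}$ be the integral closure of $k[t]$ in $F$. Let $m \in F$, and suppose that there are two primes $Q_1$ and $Q_2$ of $F$ with $v_{Q_1}(m)$ positive, $v_{Q_2}(m)$ negative, and both odd. Let $n \geq 3$, let $f_0(x) = x^2 + m$, take $\gamma = m^{2^{n-1}} - f_0^n(0)$, and set $f(x) = (x-\gamma)^2 + \gamma + m$. Then $f^n$ is irreducible over $F$, but $\overline{f^n}$ is reducible for each prime $P$ of $F$ with $v_P(m) \geq 0$.
   Context: For a polynomial $g$ in the variable $x$, $g^n$ denotes its $n$-th iterate (the $n$-fold composition), not its $n$-th power; $f_0^n(0)$ is the value at $0$ of the $n$-th iterate of $f_0$. By contrast $m^{2^{n-1}}$ is an ordinary power of $m \in F$. A function field over $k$ here is a finite extension of $k(t)$. A prime of $F$ is a discrete valuation ring $R \subset F$ that contains $k$ and has field of fractions $F$; if $P$ is its maximal ideal, both $P$ and $R$ are referred to as the prime, and $v_P : F^* \to \mathbb{Z}$ is the associated valuation ($P$-adic valuation). If $v_P(m) \geq 0$ then the coefficients of $f$ lie in $R$, and $\overline{f^n} \in (R/P)[x]$ is the coefficient-wise reduction of $f^n$ modulo $P$. *)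

theory Defs
  imports "HOL-Algebra.Algebraic_Closure_Type" "HOL-Algebra.Generated_Fields"
begin

text \<open>
  The field \<open>F\<close> is a type of class \<open>field\<close>, so that \<open>F[x]\<close> is \<open>'f poly\<close>.  Subfields, subrings and
  residue fields of \<open>F\<close> are treated with the locales of HOL-Algebra, over the record
  \<open>ring_of_type_algebra :: 'f ring\<close>, whose carrier is the whole type.  Polynomials over a record ring
  are lists of coefficients, leading coefficient first.
\<close>

hide_const (open) Divisibility.irreducible

definition function_field :: "('a, 'b) ring_scheme \<Rightarrow> 'a set \<Rightarrow> 'a \<Rightarrow> bool" where
  "function_field F k t \<longleftrightarrow>
     field F \<and> subfield k F \<and> t \<in> carrier F \<and> ring.transcendental F k t \<and>
     ring.finite_dimension F (generate_field F (insert t k)) (carrier F)"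

definition integral_closure :: "('a, 'b) ring_scheme \<Rightarrow> 'a set \<Rightarrow> 'a set" where
  "integral_closure F A =
     {x \<in> carrier F. \<exists>p \<in> carrier (univ_poly F A).
        p \<noteq> [] \<and> hd p = \<one>\<^bsub>F\<^esub> \<and> ring.eval F p x = \<zero>\<^bsub>F\<^esub>}"

definition discrete_valuation_ring :: "('a, 'b) ring_scheme \<Rightarrow> bool" where
  "discrete_valuation_ring A \<longleftrightarrow>
     principal_domain A \<and> \<not> field A \<and> (\<exists>!M. maximalideal M A)"

definition prime_of :: "('a, 'b) ring_scheme \<Rightarrow> 'a set \<Rightarrow> 'a set \<Rightarrow> 'a set \<Rightarrow> bool" where
  "prime_of F k R P \<longleftrightarrow>
     subring R F \<and> k \<subseteq> R \<and>
     discrete_valuation_ring (F\<lparr>carrier := R\<rparr>) \<and>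
     carrier F = {a \<otimes>\<^bsub>F\<^esub> inv\<^bsub>F\<^esub> b |a b. a \<in> R \<and> b \<in> R - {\<zero>\<^bsub>F\<^esub>}} \<and>
     maximalideal P (F\<lparr>carrier := R\<rparr>)"

text \<open>
  The valuation of \<open>x \<noteq> 0\<close> is the \<open>n\<close> with \<open>x = u \<pi>\<^sup>n\<close>, where \<open>u\<close> is a unit of \<open>R\<close> and \<open>\<pi>\<close> generates
  \<open>P\<close>.  At \<open>0\<close>, where it is not defined (or infinite), it is given the value \<open>0\<close>, so that
  "positive" and "negative" both entail \<open>x \<noteq> 0\<close>, while \<open>0\<close> satisfies "nonnegative".
\<close>
definition valuation :: "('a, 'b) ring_scheme \<Rightarrow> 'a set \<Rightarrow> 'a set \<Rightarrow> 'a \<Rightarrow> int" where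
  "valuation F R P x =
     (if x = \<zero>\<^bsub>F\<^esub> then 0
      else THE n. \<exists>\<pi> u. \<pi> \<in> R \<and> P = PIdl\<^bsub>F\<lparr>carrier := R\<rparr>\<^esub> \<pi> \<and> u \<in> Units (F\<lparr>carrier := R\<rparr>) \<and>
             x = u \<otimes>\<^bsub>F\<^esub> \<pi> [^]\<^bsub>F\<^esub> n)"

definition residue_ring_at :: "('a, 'b) ring_scheme \<Rightarrow> 'a set \<Rightarrow> 'a set \<Rightarrow> 'a set ring" where
  "residue_ring_at F R P = F\<lparr>carrier := R\<rparr> Quot P"

text \<open>
  Meaningful only for \<open>g\<close> with coefficients in \<open>R\<close>.  The function \<open>ring.normalize\<close> strips leading
  zeros; \<open>coeffs\<close> lists the constant coefficient first, hence \<open>rev\<close>.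
\<close>
definition reduce_poly :: "'f::field set \<Rightarrow> 'f set \<Rightarrow> 'f poly \<Rightarrow> 'f set list" where
  "reduce_poly R P g =
     ring.normalize (residue_ring_at ring_of_type_algebra R P)
       (map (\<lambda>a. P +>\<^bsub>ring_of_type_algebra\<lparr>carrier := R\<rparr>\<^esub> a) (rev (coeffs g)))"

definition reducible_in :: "('a, 'b) ring_scheme \<Rightarrow> 'a \<Rightarrow> bool" where
  "reducible_in A a \<longleftrightarrow>
     a \<in> carrier A \<and> a \<noteq> \<zero>\<^bsub>A\<^esub> \<and> a \<notin> Units A \<and> \<not> ring_irreducible\<^bsub>A\<^esub> a"

definition poly_iterate :: "'a::comm_semiring_1 poly \<Rightarrow> nat \<Rightarrow> 'a poly" where
  "poly_iterate g n = ((\<lambda>p. pcompose g p) ^^ n) [:0, 1:]"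

end

theory Submission
  imports Defs "HOL-Algebra.Sylow"
begin

text \<open>
  Write \<open>a\<^sub>i\<close> for the value at \<open>0\<close> of the \<open>i\<close>-th
  iterate of \<open>f\<^sub>0 = x\<^sup>2 + m\<close>. Since \<open>f\<close> is the conjugate of
  \<open>f\<^sub>0\<close> by the translation by \<open>\<gamma>\<close>, its \<open>i\<close>-th
  iterate is, up to translation, the polynomial \<open>g\<^sub>i\<close> that is the sum of the
  \<open>i\<close>-th iterate of \<open>f\<^sub>0\<close> and \<open>\<gamma>\<close>, and
  \<open>g\<^sub>i\<close> has constant term \<open>a\<^sub>i + \<gamma>\<close>. The choice of
  \<open>\<gamma>\<close> makes the last of these constant terms the square \<open>a\<^sub>n +
  \<gamma> = m\<^bsup>2^(n-1)\<^esup>\<close>.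

  Irreducibility over \<open>F\<close>. If \<open>q\<close> is irreducible, monic and of degree
  \<open>d\<close> but \<open>q(x\<^sup>2)\<close> is reducible, then \<open>q(x\<^sup>2) =
  (-1)\<^bsup>d\<^esup> h(x) h(-x)\<close> (\<open>reducible_square_composition\<close>), so the
  constant term is a square up to this sign. At the pole \<open>Q\<^sub>2\<close> of
  \<open>m\<close> the element \<open>a\<^sub>i + \<gamma>\<close> has odd valuation for \<open>i
  < n\<close>, so that \<open>g\<^sub>1, \<dots>, g\<^sub>n\<^sub>-\<^sub>1\<close> are
  irreducible. At level \<open>n\<close> a factorization would be \<open>g\<^sub>n = h(x)
  h(-x)\<close>. Modulo \<open>m\<^sup>2\<close> the polynomial \<open>g\<^sub>n\<close> starts
  with \<open>x\<^bsup>2D\<^esup> + \<dots> + 2 m x\<^bsup>D\<^esup>\<close>, where \<open>D =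
  2\<^bsup>n-1\<^esup>\<close>, and its lower coefficients are divisible by
  \<open>m\<^sup>2\<close>. At the zero \<open>Q\<^sub>1\<close> of \<open>m\<close> the Newton
  polygon therefore has a side of length \<open>D\<close> and height \<open>v(m)\<close>, of which
  \<open>h(x)\<close> and \<open>h(-x)\<close> would each contribute one half; so
  \<open>v(m)\<close> would be even (\<open>even_slope_if_product_with_reflection\<close>).

  Reducibility modulo \<open>P\<close>. The residue field is finite
  (\<open>finite_residue_field\<close>), with \<open>Q\<close> elements, say. If the reduction of
  \<open>g\<^sub>n\<close> were irreducible, then a root \<open>\<theta>\<close> of it would
  generate an extension of degree \<open>2\<^bsup>n\<^esup>\<close>. The conjugates of
  \<open>\<theta>\<close> are its images under powers of the Frobenius map \<open>z \<mapsto>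
  z\<^sup>Q\<close>, their product is the constant term \<open>a\<^sub>n + \<gamma>\<close>, and
  \<open>\<theta>\<close> and \<open>-\<theta>\<close> are interchanged by the \<open>D\<close>-th
  power of Frobenius. Hence the constant term is \<open>N\<^sup>2\<close>, where \<open>N\<close>
  is the product of the first \<open>D\<close> conjugates. Frobenius changes the sign of
  \<open>N\<close>, so \<open>N\<close> is not in the residue field and \<open>a\<^sub>n +
  \<gamma>\<close> is not a square there (\<open>final_critical_value_nonsquare\<close>). Since it
  is a square, the reduction is reducible. That the product of the conjugates is the constant term
  is proved by descending the tower of quadratic extensions one step at a time
  (\<open>norm_step\<close>).
\<close>

section \<open>Irreducibility of \<open>q(x\<^sup>2)\<close>\<close>

abbreviation square_poly :: "'a::comm_ring_1 poly" where "square_poly \<equiv> [:0, 0, 1:]"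
abbreviation reflect :: "'a::comm_ring_1 poly \<Rightarrow> 'a poly" where "reflect p \<equiv> pcompose p [:0, -1:]"

lemma even_odd_decomposition:
  fixes p :: "'a::comm_ring_1 poly"
  obtains a b where "p = pcompose a square_poly + [:0, 1:] * pcompose b square_poly"
proof -
  have "\<exists>a b. p = pcompose a square_poly + [:0, 1:] * pcompose b square_poly"
  proof (induction p)
    case 0
    show ?case by (intro exI[of _ 0]) simp
  next
    case (pCons c p)
    then obtain a b where p: "p = pcompose a square_poly + [:0, 1:] * pcompose b square_poly" by blast
    show ?case
      by (rule exI[of _ "pCons c b"], rule exI[of _ a], subst p)
         (simp add: pcompose_pCons algebra_simps)
  qed
  then show thesis using that by blast
qed

lemma pcompose_square_poly_eq_iff:
  fixes p q :: "'a::idom poly"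
  shows "pcompose p square_poly = pcompose q square_poly \<longleftrightarrow> p = q"
proof
  assume "pcompose p square_poly = pcompose q square_poly"
  then have "pcompose (p - q) square_poly = 0" by (simp add: pcompose_diff)
  then show "p = q" by (subst (asm) pcompose_eq_0_iff) auto
qed simp

text \<open>
  With \<open>h(x) = a(x\<^sup>2) + x b(x\<^sup>2)\<close> the product \<open>h(x) h(-x)\<close>
  is \<open>a(x\<^sup>2)\<^sup>2 - x\<^sup>2 b(x\<^sup>2)\<^sup>2\<close>: it is the norm of
  \<open>h\<close> from the polynomials in \<open>x\<close> to the polynomials in
  \<open>x\<^sup>2\<close>.
\<close>
lemma mult_reflect:
  fixes h :: "'a::idom poly"
  obtains N where "h * reflect h = pcompose N square_poly" "degree N = degree h"
proof -
  obtain a b where h: "h = pcompose a square_poly + [:0, 1:] * pcompose b square_poly"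
    by (rule even_odd_decomposition)
  have sq: "pcompose (pcompose c square_poly) [:0, -1:] = pcompose c square_poly" for c :: "'a poly"
    by (simp flip: pcompose_assoc add: pcompose_pCons)
  have "reflect h = pcompose a square_poly - [:0, 1:] * pcompose b square_poly"
    by (subst h) (simp add: pcompose_add pcompose_mult sq pcompose_pCons)
  then have "h * reflect h = (pcompose a square_poly + [:0, 1:] * pcompose b square_poly) *
      (pcompose a square_poly - [:0, 1:] * pcompose b square_poly)"
    using h by metis
  also have "\<dots> = (pcompose a square_poly)\<^sup>2 - [:0,1:]\<^sup>2 * (pcompose b square_poly)\<^sup>2"
    by (simp only: power2_eq_square ring_distribs) (simp add: mult_ac)
  also have "\<dots> = pcompose (a\<^sup>2 - [:0,1:] * b\<^sup>2) square_poly"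
    by (simp add: pcompose_diff pcompose_mult power2_eq_square pcompose_pCons)
  finally have N: "h * reflect h = pcompose (a\<^sup>2 - [:0,1:] * b\<^sup>2) square_poly" .
  have "degree (h * reflect h) = 2 * degree h"
  proof (cases "h = 0")
    case False
    then have "reflect h \<noteq> 0" by (subst pcompose_eq_0_iff) auto
    with False show ?thesis by (simp add: degree_mult_eq degree_pcompose)
  qed simp
  with N have "degree (a\<^sup>2 - [:0,1:] * b\<^sup>2) = degree h" by (simp add: degree_pcompose)
  with N that show thesis by blast
qed

text \<open>
  Multiplying a factorization of \<open>q(x\<^sup>2)\<close> with its reflection gives
  \<open>q\<^sup>2 = N M\<close>, where \<open>N\<close> and \<open>M\<close> are the norms of the
  two factors. Neither norm is a unit, and \<open>q\<close> is prime, so both norms are associated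
  to \<open>q\<close>; comparing leading coefficients gives the sign.
\<close>
lemma reflect_mult_square_factor:
  fixes q h s :: "'a::field poly"
  assumes q: "irreducible q" "lead_coeff q = 1"
    and hs: "pcompose q square_poly = h * s" "degree h > 0" "degree s > 0" and h: "lead_coeff h = 1"
  shows "degree h = degree q" "pcompose q square_poly = smult ((-1) ^ degree q) (h * reflect h)"
proof -
  obtain N where N: "h * reflect h = pcompose N square_poly" "degree N = degree h" by (rule mult_reflect)
  obtain M where M: "s * reflect s = pcompose M square_poly" "degree M = degree s" by (rule mult_reflect)
  have refl: "reflect (pcompose q square_poly) = pcompose q square_poly"
    by (simp flip: pcompose_assoc add: pcompose_pCons)
  have "pcompose (q * q) square_poly = (h * s) * reflect (h * s)"
    by (simp add: pcompose_mult hs(1)[symmetric] refl)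
  also have "\<dots> = (h * reflect h) * (s * reflect s)" by (simp add: pcompose_mult mult_ac)
  also have "\<dots> = pcompose (N * M) square_poly" by (simp add: N M pcompose_mult)
  finally have qq: "q * q = N * M" by (subst (asm) pcompose_square_poly_eq_iff)
  have q0: "q \<noteq> 0" using q by auto
  have nu: "\<not> is_unit N" "\<not> is_unit M"
    using N(2) M(2) hs by (metis is_unit_iff_degree degree_0 less_not_refl)+
  have "prime_elem q" using q(1) by (rule field_poly_irreducible_imp_prime)
  then have "q dvd N \<or> q dvd M" using qq by (metis dvd_triv_left prime_elem_dvd_mult_iff)
  then obtain c where c: "N = q * c" "is_unit c"
  proof
    assume "q dvd N"
    then obtain c where c: "N = q * c" by (elim dvdE)
    with qq q0 have "q = c * M" by (simp add: mult.assoc)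
    with irreducibleD[OF q(1)] nu(2) have "is_unit c" by blast
    with c that show thesis by blast
  next
    assume "q dvd M"
    then obtain c where c: "M = q * c" by (elim dvdE)
    with qq q0 have qc: "q = N * c" by (simp add: mult.left_commute)
    with irreducibleD[OF q(1)] nu(1) have cu: "is_unit c" by blast
    then obtain c' where c': "c * c' = 1" by (metis dvd_def)
    then have "N = q * c'" by (simp add: qc mult.assoc)
    moreover have "is_unit c'" using c' by (metis dvd_triv_right)
    ultimately show thesis using that by blast
  qed
  obtain u where u: "c = [:u:]" "u \<noteq> 0"
    using c(2) by (auto simp: is_unit_poly_iff dvd_field_iff)
  have N': "N = smult u q" using c u by simp
  then show deg: "degree h = degree q" using N(2) u by simp
  have "lead_coeff (h * reflect h) = (-1) ^ degree q"
    using h by (simp add: lead_coeff_mult lead_coeff_comp deg)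
  moreover have "lead_coeff (h * reflect h) = u"
    unfolding N(1) N' by (simp add: pcompose_smult lead_coeff_comp q)
  ultimately have u': "u = (-1) ^ degree q" by simp
  then have "u * u = 1" by (simp flip: power_mult_distrib)
  then have "smult u (h * reflect h) = pcompose q square_poly"
    by (simp add: N(1) N' pcompose_smult)
  then show "pcompose q square_poly = smult ((-1) ^ degree q) (h * reflect h)" by (simp add: u')
qed

lemma reducible_square_composition:
  fixes q :: "'a::field poly"
  assumes q: "irreducible q" "lead_coeff q = 1" and red: "\<not> irreducible (pcompose q square_poly)"
  obtains h where "lead_coeff h = 1" "degree h = degree q"
    "pcompose q square_poly = smult ((-1) ^ degree q) (h * reflect h)"
proof -
  let ?p = "pcompose q square_poly"
  have q0: "q \<noteq> 0" using q by auto
  have dq: "degree q > 0" using q by (metis gr0I is_unit_iff_degree irreducible_not_unit q0)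
  have dp: "degree ?p = 2 * degree q" by (simp add: degree_pcompose)
  have p0: "?p \<noteq> 0" using dp dq by auto
  have "\<not> is_unit ?p" using dp dq p0 is_unit_iff_degree by (metis mult_pos_pos not_less0 zero_less_numeral)
  then obtain h s where hs: "?p = h * s" "\<not> is_unit h" "\<not> is_unit s"
    using red p0 unfolding irreducible_def by blast
  have h0: "h \<noteq> 0" "s \<noteq> 0" using hs p0 by auto
  then have d: "degree h > 0" "degree s > 0" using hs by (auto simp: is_unit_iff_degree)
  define c where "c = lead_coeff h"
  have c: "c \<noteq> 0" using h0 by (simp add: c_def)
  have 1: "?p = smult (inverse c) h * smult c s" using hs c by simp
  have 2: "lead_coeff (smult (inverse c) h) = 1" using c by (simp add: c_def)
  show thesis
    using reflect_mult_square_factor[OF q 1 _ _ 2] that[OF 2] d c by simp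
qed

lemma irreducible_pcompose_linear:
  fixes p :: "'a::field poly"
  assumes "irreducible p"
  shows "irreducible (pcompose p [:c, 1:])"
proof (rule irreducibleI)
  have inv: "pcompose (pcompose r [:c, 1:]) [:-c, 1:] = r" "pcompose (pcompose r [:-c, 1:]) [:c, 1:] = r" for r :: "'a poly"
    by (simp_all flip: pcompose_assoc add: pcompose_pCons)
  have p: "p \<noteq> 0" "\<not> is_unit p" using assms by (auto simp: irreducible_def)
  have unit: "is_unit (pcompose r [:d, 1:]) \<longleftrightarrow> is_unit r" for r and d :: 'a
  proof (cases "r = 0")
    case False
    then have "pcompose r [:d, 1:] \<noteq> 0" by (subst pcompose_eq_0_iff) auto
    with False show ?thesis by (simp add: is_unit_iff_degree degree_pcompose)
  qed simp
  show "pcompose p [:c, 1:] \<noteq> 0" using p by (subst pcompose_eq_0_iff) auto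
  show "\<not> is_unit (pcompose p [:c, 1:])" using p by (simp add: unit)
  fix a b assume "pcompose p [:c, 1:] = a * b"
  then have "p = pcompose a [:-c, 1:] * pcompose b [:-c, 1:]" by (metis inv(1) pcompose_mult)
  then show "is_unit a \<or> is_unit b" using irreducibleD[OF assms] unit by blast
qed

section \<open>Iterates of \<open>x\<^sup>2 + m\<close>\<close>

lemma poly_iterate_0 [simp]: "poly_iterate f 0 = [:0, 1:]"
  by (simp add: poly_iterate_def)

lemma poly_iterate_Suc: "poly_iterate f (Suc n) = pcompose f (poly_iterate f n)"
  by (simp add: poly_iterate_def)

lemma poly_iterate_Suc':
  fixes f :: "'a::comm_ring_1 poly"
  shows "poly_iterate f (Suc n) = pcompose (poly_iterate f n) f"
proof (induction n)
  case (Suc n)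
  then show ?case by (metis poly_iterate_Suc pcompose_assoc)
qed (simp add: poly_iterate_Suc pcompose_pCons)

abbreviation quad :: "'a::comm_ring_1 \<Rightarrow> 'a poly" where "quad m \<equiv> [:m, 0, 1:]"

lemma poly_iterate_quad_Suc:
  fixes m :: "'a::comm_ring_1"
  shows "poly_iterate (quad m) (Suc n) = (poly_iterate (quad m) n)\<^sup>2 + [:m:]"
  by (simp add: poly_iterate_Suc pcompose_pCons power2_eq_square)

lemma degree_poly_iterate_quad [simp]:
  fixes m :: "'a::idom"
  shows "degree (poly_iterate (quad m) n) = 2 ^ n"
  by (induction n) (simp_all add: poly_iterate_Suc degree_pcompose)

lemma lead_coeff_poly_iterate_quad:
  fixes m :: "'a::idom"
  shows "lead_coeff (poly_iterate (quad m) n) = 1"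
proof (induction n)
  case (Suc n)
  have "lead_coeff (poly_iterate (quad m) (Suc n)) = lead_coeff (poly_iterate (quad m) n) ^ 2"
    unfolding poly_iterate_Suc by (subst lead_coeff_comp) (auto simp: power2_eq_square)
  with Suc show ?case by (metis power_one)
qed simp

lemma poly_iterate_conjugate:
  fixes m \<gamma> :: "'a::comm_ring_1"
  shows "poly_iterate (([:0, 1:] - [:\<gamma>:])\<^sup>2 + [:\<gamma> + m:]) n =
    pcompose (poly_iterate (quad m) n) [:-\<gamma>, 1:] + [:\<gamma>:]"
proof (induction n)
  case (Suc n)
  let ?u = "pcompose (poly_iterate (quad m) n) [:-\<gamma>, 1:]"
  have "poly_iterate (([:0, 1:] - [:\<gamma>:])\<^sup>2 + [:\<gamma> + m:]) (Suc n) =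
      (?u + [:\<gamma>:] - [:\<gamma>:])\<^sup>2 + [:\<gamma> + m:]"
    unfolding poly_iterate_Suc Suc
    by (simp only: power2_eq_square pcompose_add pcompose_diff pcompose_mult pcompose_const)
       (simp add: pcompose_pCons)
  also have "\<dots> = pcompose (poly_iterate (quad m) (Suc n)) [:-\<gamma>, 1:] + [:\<gamma>:]"
    by (simp add: poly_iterate_quad_Suc power2_eq_square pcompose_add pcompose_mult)
  finally show ?case .
qed (simp add: pcompose_pCons)

text \<open>
  Each iterate arises from the preceding one by substituting \<open>x\<^sup>2 + m\<close>. If this
  destroys irreducibility at step \<open>i\<close>, then the constant terms in the factorization
  above show that the constant term is \<open>(-1)\<^bsup>d\<^esup>\<close> times a square, where
  \<open>d = 2\<^bsup>i-1\<^esup>\<close>; the sign is negative for \<open>i = 1\<close> only.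
\<close>
lemma irreducible_iterate_plus_const:
  fixes m c :: "'a::field"
  assumes two: "(2::'a) \<noteq> 0"
    and ns: "\<And>y. -(m + c) \<noteq> y\<^sup>2" "\<And>i y. 2 \<le> i \<Longrightarrow> i \<le> n \<Longrightarrow> poly (poly_iterate (quad m) i) 0 + c \<noteq> y\<^sup>2"
  shows "irreducible (poly_iterate (quad m) n + [:c:])"
  using ns(2)
proof (induction n)
  case 0
  show ?case by (simp add: irreducible_linear_field_poly)
next
  case (Suc n)
  let ?g = "poly_iterate (quad m) n + [:c:]"
  let ?q = "pcompose ?g [:m, 1:]"
  have irr: "irreducible ?q" using Suc by (intro irreducible_pcompose_linear) auto
  have deg: "degree ?g = 2 ^ n" by (simp add: degree_add_eq_left)
  have "coeff [:c:] (2 ^ n) = 0" by (rule coeff_eq_0) simp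
  moreover have "coeff (poly_iterate (quad m) n) (2 ^ n) = 1"
    using lead_coeff_poly_iterate_quad[of m n] by simp
  ultimately have lc: "lead_coeff ?g = 1" by (simp only: deg coeff_add) simp
  have "lead_coeff ?q = lead_coeff ?g" by (subst lead_coeff_comp) simp_all
  with deg lc have q: "degree ?q = 2 ^ n" "lead_coeff ?q = 1" by (simp_all only: degree_pcompose) simp
  have p: "poly_iterate (quad m) (Suc n) + [:c:] = pcompose ?q square_poly"
    by (simp add: poly_iterate_Suc' pcompose_add pcompose_pCons flip: pcompose_assoc)
  show ?case
  proof (rule ccontr)
    assume "\<not> ?thesis"
    with p have "\<not> irreducible (pcompose ?q square_poly)" by metis
    with irr q(2) obtain h where h: "pcompose ?q square_poly = smult ((-1) ^ degree ?q) (h * reflect h)"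
      by (rule reducible_square_composition)
    have "poly (poly_iterate (quad m) (Suc n) + [:c:]) 0 = (-1) ^ 2 ^ n * (poly h 0)\<^sup>2"
      unfolding p h q(1) by (simp add: poly_pcompose power2_eq_square)
    then have *: "poly (poly_iterate (quad m) (Suc n)) 0 + c = (-1) ^ 2 ^ n * (poly h 0)\<^sup>2" by simp
    show False
    proof (cases n)
      case 0
      with * have "m + c = - (poly h 0)\<^sup>2" by (simp add: poly_iterate_Suc)
      then have "-(m + c) = (poly h 0)\<^sup>2" by simp
      with ns(1) show False by blast
    next
      case (Suc k)
      then show False using Suc.prems * by auto
    qed
  qed
qed

section \<open>Valuations and Newton polygons\<close>

text \<open>
  The value of \<open>v\<close> at \<open>0\<close> is left open, so that it need not be infinite;
  lower bounds on valuations are expressed by \<open>ge\<close>, for which \<open>0\<close> has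
  valuation infinity.
\<close>
locale valued_field =
  fixes v :: "'a::field \<Rightarrow> int"
  assumes mult: "x \<noteq> 0 \<Longrightarrow> y \<noteq> 0 \<Longrightarrow> v (x * y) = v x + v y"
    and add: "x \<noteq> 0 \<Longrightarrow> y \<noteq> 0 \<Longrightarrow> x + y \<noteq> 0 \<Longrightarrow> min (v x) (v y) \<le> v (x + y)"
begin

definition ge :: "int \<Rightarrow> 'a \<Rightarrow> bool" where "ge c x \<longleftrightarrow> x = 0 \<or> c \<le> v x"

lemma one [simp]: "v 1 = 0"
  using mult[of 1 1] by simp

lemma minus [simp]: "v (- x) = v x"
proof (cases "x = 0")
  case False
  have "v (-1) + v (-1) = 0" using mult[of "-1" "-1"] by simp
  then show ?thesis using mult[of "-1" x] False by simp
qed simp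

lemma power: "x \<noteq> 0 \<Longrightarrow> v (x ^ k) = int k * v x"
  by (induction k) (simp_all add: mult algebra_simps)

lemma ge_0 [simp]: "ge c 0" by (simp add: ge_def)

lemma ge_mono: "ge c x \<Longrightarrow> d \<le> c \<Longrightarrow> ge d x"
  by (auto simp: ge_def)

lemma ge_add: "ge c x \<Longrightarrow> ge c y \<Longrightarrow> ge c (x + y)"
  using add[of x y] by (cases "x = 0 \<or> y = 0 \<or> x + y = 0") (auto simp: ge_def)

lemma ge_minus [simp]: "ge c (- x) \<longleftrightarrow> ge c x" by (simp add: ge_def)

lemma ge_diff: "ge c x \<Longrightarrow> ge c y \<Longrightarrow> ge c (x - y)"
  using ge_add[of c x "-y"] by simp

lemma ge_mult: "ge c x \<Longrightarrow> ge d y \<Longrightarrow> ge (c + d) (x * y)"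
  using mult[of x y] by (cases "x = 0 \<or> y = 0") (auto simp: ge_def)

lemma ge_sum: "(\<And>i. i \<in> A \<Longrightarrow> ge c (f i)) \<Longrightarrow> ge c (sum f A)"
  by (induction A rule: infinite_finite_induct) (auto intro: ge_add)

lemma dominant_add:
  assumes "x \<noteq> 0" "ge (v x + 1) y"
  shows "x + y \<noteq> 0" "v (x + y) = v x"
proof -
  show ne: "x + y \<noteq> 0"
  proof
    assume "x + y = 0"
    then have "y = - x" by (simp add: eq_neg_iff_add_eq_0 add.commute)
    then show False using assms by (simp add: ge_def)
  qed
  have "ge (v x) (x + y)" using assms(2) by (intro ge_add) (auto simp: ge_def)
  moreover have "\<not> ge (v x + 1) (x + y)"
    using ge_diff[of "v x + 1" "x + y" y] assms by (auto simp: ge_def)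
  ultimately show "v (x + y) = v x" using ne by (auto simp: ge_def)
qed

text \<open>
  Give the term \<open>h\<^sub>i x\<^sup>i\<close> the weight \<open>D v(h\<^sub>i) + i e\<close>;
  comparing weights is the Newton polygon argument for the slope \<open>e / D\<close>. If
  \<open>i\<close> is the smallest index of least weight \<open>\<mu>\<close> in \<open>h\<close>,
  then \<open>\<plusminus>h\<^sub>i\<^sup>2\<close> is the only term of weight
  \<open>2\<mu>\<close> in the coefficient of \<open>x\<^bsup>2i\<^esup>\<close> of \<open>h(x)
  h(-x)\<close>, and no coefficient of lower degree has this weight. The bounds on the product
  force \<open>\<mu> = D e\<close> and \<open>2 i = D\<close>, so \<open>D v(h\<^sub>i) = D e - i
  e\<close> gives \<open>2 v(h\<^sub>i) = e\<close>.
\<close>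
lemma even_slope_if_product_with_reflection:
  fixes h :: "'a poly"
  defines "H \<equiv> h * reflect h"
  assumes D: "degree h = D" "lead_coeff h = 1" "D > 0" and e: "e > 0"
    and H: "ge (2 * e + 1) (coeff H 0)" "\<And>k. 0 < k \<Longrightarrow> k < D \<Longrightarrow> ge (2 * e) (coeff H k)"
      "coeff H D \<noteq> 0" "v (coeff H D) = e" "\<And>k. D < k \<Longrightarrow> k < 2 * D \<Longrightarrow> ge e (coeff H k)"
  shows "even e"
proof -
  define w where "w k x = int D * v x + int k * e" for k x
  have w_mult: "w (i + j) (x * y) = w i x + w j y" if "x \<noteq> 0" "y \<noteq> 0" for i j x y
    using that by (simp add: w_def mult algebra_simps)
  define A where "A = {i. coeff h i \<noteq> 0}"
  have "A \<subseteq> {..D}" using D(1) by (auto simp: A_def le_degree)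
  then have A: "finite A" "D \<in> A" using D by (auto simp: A_def finite_subset)
  define \<mu> where "\<mu> = Min ((\<lambda>i. w i (coeff h i)) ` A)"
  have \<mu>: "\<mu> \<le> w i (coeff h i)" if "coeff h i \<noteq> 0" for i
    using A that by (auto simp: \<mu>_def A_def)
  define i0 where "i0 = (LEAST i. i \<in> A \<and> w i (coeff h i) = \<mu>)"
  have "\<mu> \<in> (\<lambda>i. w i (coeff h i)) ` A" unfolding \<mu>_def using A by (intro Min_in) auto
  then have "\<exists>i. i \<in> A \<and> w i (coeff h i) = \<mu>" by auto
  from LeastI_ex[OF this] have i0: "coeff h i0 \<noteq> 0" "w i0 (coeff h i0) = \<mu>"
    unfolding i0_def[symmetric] by (auto simp: A_def)
  have i0_least: "\<mu> < w i (coeff h i)" if "coeff h i \<noteq> 0" "i < i0" for i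
    using not_less_Least[of i "\<lambda>i. i \<in> A \<and> w i (coeff h i) = \<mu>"] that \<mu>[of i]
    by (fastforce simp: i0_def A_def)
  define T where "T k i = coeff h i * ((-1) ^ (k - i) * coeff h (k - i))" for k i
  have coeff_H: "coeff H k = (\<Sum>i\<le>k. T k i)" for k
    by (simp add: H_def coeff_mult coeff_pcompose_linear T_def)
  have sgn: "(-1::'a) ^ k \<noteq> 0" "v ((-1) ^ k) = 0" for k
    by (simp, cases "even k") simp_all
  have T_weight: "w k (T k i) = w i (coeff h i) + w (k - i) (coeff h (k - i))"
    if "T k i \<noteq> 0" "i \<le> k" for k i
  proof -
    have *: "coeff h i \<noteq> 0" "coeff h (k - i) \<noteq> 0" using that by (auto simp: T_def)
    have "w (i + (k - i)) (T k i) = w i (coeff h i) + w (k - i) ((-1) ^ (k - i) * coeff h (k - i))"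
      unfolding T_def using * sgn by (intro w_mult) auto
    also have "w (k - i) ((-1) ^ (k - i) * coeff h (k - i)) = w (k - i) (coeff h (k - i))"
      using * sgn by (simp add: w_def mult)
    finally show ?thesis using that by simp
  qed
  have weight_ge: "x = 0 \<or> c \<le> w k x \<longleftrightarrow> ge (- ((int k * e - c) div int D)) x" for c k x
  proof -
    have "c \<le> int D * y + int k * e \<longleftrightarrow> - ((int k * e - c) div int D) \<le> y" for y
    proof -
      have "z * int D \<le> x \<longleftrightarrow> z \<le> x div int D" for x z
      proof
        assume "z * int D \<le> x"
        from zdiv_mono1[OF this, of "int D"] D(3) show "z \<le> x div int D" by simp
      next
        assume "z \<le> x div int D"
        then have "z * int D \<le> (x div int D) * int D" by (rule mult_right_mono) simp
        also have "\<dots> \<le> x" using pos_mod_sign[of "int D" x] D(3) div_mult_mod_eq[of x "int D"] by linarith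
        finally show "z * int D \<le> x" .
      qed
      from this[of "- y" "int k * e - c"] show ?thesis by (auto simp: algebra_simps)
    qed
    then show ?thesis by (simp add: ge_def w_def)
  qed
  have weight_sum: "sum f B = 0 \<or> c \<le> w k (sum f B)" if "\<And>i. i \<in> B \<Longrightarrow> f i = 0 \<or> c \<le> w k (f i)"
    for f :: "nat \<Rightarrow> 'a" and B c k
    using that unfolding weight_ge by (rule ge_sum)
  \<comment> \<open>below degree \<open>2 i0\<close> one of the two factors of each term has an index below \<open>i0\<close>\<close>
  have H_low: "coeff H k = 0 \<or> 2 * \<mu> + 1 \<le> w k (coeff H k)" if "k < 2 * i0" for k
    unfolding coeff_H
  proof (rule weight_sum)
    fix i assume "i \<in> {..k}"
    then have "i < i0 \<or> k - i < i0" "i \<le> k" using that by auto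
    then show "T k i = 0 \<or> 2 * \<mu> + 1 \<le> w k (T k i)"
      using T_weight[of k i] i0_least[of i] i0_least[of "k - i"] \<mu>[of i] \<mu>[of "k - i"]
      by (cases "T k i = 0") (auto simp: T_def)
  qed
  have H_all: "coeff H k = 0 \<or> 2 * \<mu> \<le> w k (coeff H k)" for k
    unfolding coeff_H
  proof (rule weight_sum)
    fix i assume "i \<in> {..k}"
    then show "T k i = 0 \<or> 2 * \<mu> \<le> w k (T k i)"
      using T_weight[of k i] \<mu>[of i] \<mu>[of "k - i"]
      by (cases "T k i = 0") (auto simp: T_def)
  qed
  define S where "S = (\<Sum>i\<in>{..2 * i0} - {i0}. T (2 * i0) i)"
  have T0: "T (2 * i0) i0 \<noteq> 0" using i0(1) by (simp add: T_def)
  have wT0: "w (2 * i0) (T (2 * i0) i0) = 2 * \<mu>" using T_weight[OF T0] i0(2) by simp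
  have HS: "coeff H (2 * i0) = T (2 * i0) i0 + S"
    unfolding coeff_H S_def by (subst sum.remove[of _ i0]) auto
  have S: "S = 0 \<or> 2 * \<mu> + 1 \<le> w (2 * i0) S"
    unfolding S_def
  proof (rule weight_sum)
    fix i assume "i \<in> {..2 * i0} - {i0}"
    then have "i < i0 \<or> 2 * i0 - i < i0" "i \<le> 2 * i0" by auto
    then show "T (2 * i0) i = 0 \<or> 2 * \<mu> + 1 \<le> w (2 * i0) (T (2 * i0) i)"
      using T_weight[of "2 * i0" i] i0_least[of i] i0_least[of "2 * i0 - i"] \<mu>[of i] \<mu>[of "2 * i0 - i"]
      by (cases "T (2 * i0) i = 0") (auto simp: T_def)
  qed
  have "ge (v (T (2 * i0) i0) + 1) S"
  proof (cases "S = 0")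
    case False
    with S wT0 have "w (2 * i0) (T (2 * i0) i0) < w (2 * i0) S" by simp
    then have "v (T (2 * i0) i0) < v S" using D(3) by (simp add: w_def)
    then show ?thesis by (simp add: ge_def)
  qed simp
  from dominant_add[OF T0 this] have H0: "coeff H (2 * i0) \<noteq> 0" "w (2 * i0) (coeff H (2 * i0)) = 2 * \<mu>"
    using wT0 by (simp_all add: HS w_def)
  have H_top: "k \<le> 2 * D" if "coeff H k \<noteq> 0" for k
  proof -
    have "degree H \<le> 2 * D" using degree_mult_le[of h "reflect h"] D(1)
      by (simp add: H_def degree_pcompose)
    then show ?thesis using le_degree[OF that] by simp
  qed
  have top: "v (coeff H (2 * D)) = 0" if "coeff H (2 * D) \<noteq> 0"
  proof -
    have "coeff H (2 * D) = coeff h D * coeff (reflect h) D"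
      unfolding H_def using coeff_mult_degree_sum[of h "reflect h"] D(1)
      by (simp add: degree_pcompose mult_2)
    then show ?thesis using D sgn by (simp add: coeff_pcompose_linear)
  qed
  \<comment> \<open>all coefficients of the product have weight at least \<open>2 D e\<close>, more so below degree \<open>D\<close>\<close>
  have given: "(k < D \<longrightarrow> 2 * int D * e < w k (coeff H k)) \<and> 2 * int D * e \<le> w k (coeff H k)"
    if k: "coeff H k \<noteq> 0" for k
  proof -
    consider "k = 0" | "0 < k" "k < D" | "k = D" | "D < k" "k < 2 * D" | "k = 2 * D"
      using H_top[OF k] D(3) by linarith
    then show ?thesis
    proof cases
      case 1
      then have "2 * e < v (coeff H k)" using H(1) k by (auto simp: ge_def)
      then have "int D * (2 * e) < int D * v (coeff H k)" using D(3) by (intro mult_strict_left_mono) auto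
      then show ?thesis using 1 by (simp add: w_def algebra_simps)
    next
      case 2
      then have "int D * (2 * e) \<le> int D * v (coeff H k)" using H(2)[of k] k by (intro mult_left_mono) (auto simp: ge_def)
      moreover have "0 < int k * e" using 2 e by simp
      ultimately show ?thesis by (simp add: w_def algebra_simps)
    next
      case 3
      then show ?thesis using H(4) by (simp add: w_def)
    next
      case 4
      then have "int D * e \<le> int D * v (coeff H k)" using H(5)[of k] k by (intro mult_left_mono) (auto simp: ge_def)
      moreover have "int D * e \<le> int k * e" using 4 e by simp
      ultimately have "2 * int D * e \<le> int D * v (coeff H k) + int k * e" by linarith
      then show ?thesis using 4 by (simp add: w_def)
    next
      case 5
      then show ?thesis using top k by (simp add: w_def)
    qed
  qed
  have wD: "w D (coeff H D) = 2 * int D * e" using H(4) by (simp add: w_def)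
  have "2 * \<mu> = 2 * int D * e"
    using H_all[of D] H(3) wD given[OF H0(1)] H0(2) by auto
  then have "2 * i0 = D"
    using H_low[of D] H(3) wD given[OF H0(1)] H0(2) by (cases "D < 2 * i0"; cases "2 * i0 < D") auto
  have "int D * (2 * v (coeff h i0)) = int D * e"
    using i0(2) \<open>2 * \<mu> = 2 * int D * e\<close> \<open>2 * i0 = D\<close>[symmetric] by (simp add: w_def algebra_simps)
  then have "2 * v (coeff h i0) = e" using D(3) by simp
  then show "even e" by (metis dvd_triv_left)
qed

end

section \<open>The critical orbit under a valuation\<close>

abbreviation crit_orbit :: "'a::comm_ring_1 \<Rightarrow> nat \<Rightarrow> 'a" where
  "crit_orbit m i \<equiv> poly (poly_iterate (quad m) i) 0"

lemma crit_orbit_Suc: "crit_orbit m (Suc i) = (crit_orbit m i)\<^sup>2 + m"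
  by (simp add: poly_iterate_quad_Suc)

context valued_field
begin

text \<open>
  As a polynomial in \<open>m\<close>, the \<open>i\<close>-th point of the critical orbit is
  \<open>m\<^bsup>2^(i-1)\<^esup> + 2\<^bsup>i-2\<^esup> m\<^bsup>2^(i-1)-1\<^esup>\<close> plus
  lower powers. At a pole of \<open>m\<close> the second term decides, which follows by induction
  from \<open>a\<^sup>2 + m - M\<^sup>2 = (a - M) (2 M + (a - M)) + m\<close>, where
  \<open>a\<close> is a point of the orbit and \<open>M\<close> its leading power of
  \<open>m\<close>.
\<close>
lemma crit_orbit_minus_power:
  assumes m: "v m < 0" "m \<noteq> 0" and two: "(2::'a) \<noteq> 0" "v 2 = 0"
  shows "crit_orbit m (i + 2) - m ^ 2 ^ (i + 1) \<noteq> 0 \<and>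
    v (crit_orbit m (i + 2) - m ^ 2 ^ (i + 1)) = (2 ^ (i + 1) - 1) * v m"
proof (induction i)
  case 0
  show ?case using m by (simp add: numeral_2_eq_2 crit_orbit_Suc)
next
  case (Suc i)
  let ?M = "m ^ 2 ^ (i + 1)" and ?d = "crit_orbit m (i + 2) - m ^ 2 ^ (i + 1)"
  have vM: "v ?M = 2 ^ (i + 1) * v m" using m(2) by (simp add: power)
  have v2M: "2 * ?M \<noteq> 0" "v (2 * ?M) = 2 ^ (i + 1) * v m"
    using m(2) two vM by (simp_all add: mult)
  have "v ?d = v (2 * ?M) - v m" using Suc v2M by (simp add: algebra_simps)
  then have "ge (v (2 * ?M) + 1) ?d" using m(1) by (simp add: ge_def)
  from dominant_add[OF v2M(1) this] v2M(2)
  have s: "2 * ?M + ?d \<noteq> 0" "v (2 * ?M + ?d) = 2 ^ (i + 1) * v m" by simp_all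
  have prod: "?d * (2 * ?M + ?d) \<noteq> 0" "v (?d * (2 * ?M + ?d)) = (2 ^ (i + 2) - 1) * v m"
    using Suc s mult[of ?d "2 * ?M + ?d"] by (simp, simp add: algebra_simps)
  have "(1::int) \<le> 2 ^ i" by simp
  then have "(1::int) < 4 * 2 ^ i - 1" by linarith
  then have "(1::int) < 2 ^ (i + 2) - 1" by simp
  then have "(2 ^ (i + 2) - 1) * v m < 1 * v m" using m(1) by (subst mult_less_cancel_right) simp
  with prod have "ge (v (?d * (2 * ?M + ?d)) + 1) m" by (simp add: ge_def)
  from dominant_add[OF prod(1) this] prod(2)
  have "?d * (2 * ?M + ?d) + m \<noteq> 0" "v (?d * (2 * ?M + ?d) + m) = (2 ^ (i + 2) - 1) * v m" by simp_all
  moreover have "?d * (2 * ?M + ?d) + m = crit_orbit m (Suc i + 2) - m ^ 2 ^ (Suc i + 1)"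
  proof -
    have "m ^ 2 ^ (Suc i + 1) = ?M\<^sup>2" by (simp add: power_mult[symmetric] mult.commute)
    moreover have "crit_orbit m (Suc i + 2) = (crit_orbit m (i + 2))\<^sup>2 + m"
      using crit_orbit_Suc[of m "i + 2"] by simp
    ultimately show ?thesis by (simp add: power2_eq_square algebra_simps)
  qed
  ultimately show ?case by simp
qed

lemma crit_orbit_pole:
  assumes m: "v m < 0" "m \<noteq> 0" and i: "i \<ge> 1"
  shows "crit_orbit m i \<noteq> 0 \<and> v (crit_orbit m i) = 2 ^ (i - 1) * v m"
  using i
proof (induction i rule: dec_induct)
  case base
  show ?case using m by (simp add: poly_iterate_Suc)
next
  case (step i)
  let ?s = "(crit_orbit m i)\<^sup>2"
  have "i = Suc (i - 1)" using step by simp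
  then have "(2::int) ^ i = 2 * 2 ^ (i - 1)" by (metis power_Suc)
  with step have s: "?s \<noteq> 0" "v ?s = 2 ^ i * v m" by (simp_all add: power)
  have "(2::int) ^ 1 \<le> 2 ^ i" using step(1) by (intro power_increasing) auto
  then have "2 ^ i * v m < 1 * v m" using m(1) by (subst mult_less_cancel_right) simp
  with s have "ge (v ?s + 1) m" by (simp add: ge_def)
  from dominant_add[OF s(1) this] s(2) show ?case by (simp add: crit_orbit_Suc)
qed

text \<open>
  The constant \<open>\<gamma>\<close> has valuation \<open>(2\<^bsup>n-1\<^esup> - 1)
  v(m)\<close>, which is odd and, because \<open>2\<^bsup>n-2\<^esup> < 2\<^bsup>n-1\<^esup> -
  1\<close> for \<open>n \<ge> 3\<close>, less than the valuation of every earlier point of the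
  critical orbit.
\<close>
lemma critical_orbit_nonsquare_at_pole:
  assumes m: "v m < 0" "odd (v m)" "m \<noteq> 0" and two: "(2::'a) \<noteq> 0" "v 2 = 0" and n: "n \<ge> 3"
    and i: "1 \<le> i" "i < n"
  shows "odd (v (crit_orbit m i + (m ^ 2 ^ (n - 1) - crit_orbit m n)))"
    and "crit_orbit m i + (m ^ 2 ^ (n - 1) - crit_orbit m n) \<noteq> 0"
proof -
  let ?\<gamma> = "m ^ 2 ^ (n - 1) - crit_orbit m n"
  define j where "j = n - 2"
  have j: "n = j + 2" "j \<ge> 1" using n by (auto simp: j_def)
  have "- ?\<gamma> \<noteq> 0 \<and> v (- ?\<gamma>) = (2 ^ (n - 1) - 1) * v m"
    using crit_orbit_minus_power[OF m(1,3) two, of j] by (simp add: j)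
  then have \<gamma>: "?\<gamma> \<noteq> 0" "v ?\<gamma> = (2 ^ (n - 1) - 1) * v m" by (auto simp only: minus neg_equal_0_iff_equal)
  have a: "crit_orbit m i \<noteq> 0" "v (crit_orbit m i) = 2 ^ (i - 1) * v m"
    using crit_orbit_pole[OF m(1,3) i(1)] by auto
  have "(2::int) ^ (i - 1) \<le> 2 ^ j" using i j by (intro power_increasing) auto
  moreover have "(2::int) \<le> 2 ^ j" using j power_increasing[of 1 j "2::int"] by simp
  ultimately have "(2::int) ^ (i - 1) < 2 * 2 ^ j - 1" by linarith
  then have "(2::int) ^ (i - 1) < 2 ^ (n - 1) - 1" using j(1) by simp
  then have "(2 ^ (n - 1) - 1) * v m < 2 ^ (i - 1) * v m" using m(1) by (subst mult_less_cancel_right) simp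
  with a \<gamma> have "ge (v ?\<gamma> + 1) (crit_orbit m i)" by (simp add: ge_def)
  from dominant_add[OF \<gamma>(1) this]
  have "?\<gamma> + crit_orbit m i \<noteq> 0" "v (?\<gamma> + crit_orbit m i) = (2 ^ (n - 1) - 1) * v m"
    using \<gamma>(2) by auto
  then show "odd (v (crit_orbit m i + ?\<gamma>))" "crit_orbit m i + ?\<gamma> \<noteq> 0"
    using m(2) j by (simp_all add: add.commute)
qed

definition integral_poly :: "'a poly \<Rightarrow> bool" where
  "integral_poly p \<longleftrightarrow> (\<forall>i. ge 0 (coeff p i))"

lemma integral_poly_add: "integral_poly p \<Longrightarrow> integral_poly q \<Longrightarrow> integral_poly (p + q)"
  by (simp add: integral_poly_def ge_add)

lemma integral_poly_mult: "integral_poly p \<Longrightarrow> integral_poly q \<Longrightarrow> integral_poly (p * q)"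
  by (auto simp: integral_poly_def coeff_mult intro!: ge_sum ge_mult[of 0 _ 0, simplified])

lemma integral_poly_smult: "ge 0 c \<Longrightarrow> integral_poly q \<Longrightarrow> integral_poly (smult c q)"
  using ge_mult[of 0 c 0] by (auto simp: integral_poly_def)

lemma integral_poly_const: "ge 0 c \<Longrightarrow> integral_poly [:c:]"
  by (auto simp: integral_poly_def coeff_pCons split: nat.splits)

lemma integral_poly_monom: "integral_poly (Polynomial.monom 1 k)"
  by (auto simp: integral_poly_def ge_def)

text \<open>
  Modulo \<open>m\<^sup>2\<close> the \<open>n\<close>-th iterate of \<open>x\<^sup>2 + m\<close> is \<open>x\<^bsup>2^n\<^esup> + m A\<^sub>n\<close> with
  \<open>A\<^sub>n = 1 + 2 x\<^bsup>2^(n-1)\<^esup> A\<^sub>n\<^sub>-\<^sub>1\<close>, since squaring doubles the part linear in \<open>m\<close>.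
\<close>
lemma iterate_mod_square:
  assumes m: "ge 0 m" and two: "ge 0 2"
  shows "\<exists>A B C. integral_poly A \<and> integral_poly B \<and> integral_poly C \<and>
    poly_iterate (quad m) (Suc n) = Polynomial.monom 1 (2 ^ Suc n) + smult m B + smult (m\<^sup>2) C \<and>
    B = 1 + smult 2 (Polynomial.monom 1 (2 ^ n) * A) \<and> (n > 0 \<longrightarrow> coeff A 0 = 1)"
proof (induction n)
  case 0
  show ?case
    by (rule exI[of _ 0], rule exI[of _ 1], rule exI[of _ 0])
      (use integral_poly_monom[of 0] integral_poly_const[of 0] in
        \<open>simp add: poly_iterate_Suc monom_0 monom_Suc numeral_2_eq_2 pcompose_pCons one_pCons\<close>)
next
  case (Suc n)
  then obtain A B C where IH: "integral_poly A" "integral_poly B" "integral_poly C"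
    "poly_iterate (quad m) (Suc n) = Polynomial.monom 1 (2 ^ Suc n) + smult m B + smult (m\<^sup>2) C"
    "B = 1 + smult 2 (Polynomial.monom 1 (2 ^ n) * A)" by blast
  let ?X = "Polynomial.monom (1::'a) (2 ^ Suc n)"
  let ?C = "B * B + smult 2 (?X * C) + smult (2 * m) (B * C) + smult (m * m) (C * C)"
  have X: "?X * ?X = Polynomial.monom 1 (2 ^ Suc (Suc n))" by (simp add: mult_monom)
  have 1: "poly_iterate (quad m) (Suc (Suc n)) =
    Polynomial.monom 1 (2 ^ Suc (Suc n)) + smult m (1 + smult 2 (?X * B)) + smult (m\<^sup>2) ?C"
  proof -
    have "(Y + M * B + M\<^sup>2 * C)\<^sup>2 + M = Y * Y + M * (1 + 2 * (Y * B)) +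
        M\<^sup>2 * (B * B + 2 * (Y * C) + 2 * M * (B * C) + M * M * (C * C))" for Y M :: "'a poly"
      by (simp add: power2_eq_square algebra_simps)
    from this[of ?X "[:m:]"] show ?thesis
      unfolding poly_iterate_quad_Suc[of m "Suc n"] IH(4) X[symmetric]
      by (simp add: power2_eq_square numeral_poly mult.commute[of 2 m])
  qed
  have 2: "coeff B 0 = 1"
    by (simp add: IH(5) coeff_mult)
  have ge2: "ge 0 (2 * m)" "ge 0 (m * m)" using ge_mult[of 0 _ 0] m two by auto
  have "integral_poly ?C" "integral_poly (1 + smult 2 (?X * B))"
    using IH(2,3) ge2 two integral_poly_monom[of 0]
    by (auto intro!: integral_poly_add integral_poly_mult integral_poly_smult integral_poly_monom)
  with 1 2 IH(2) show ?case by blast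
qed

end

text \<open>
  Up to level \<open>n - 1\<close> irreducibility is decided by nonsquares, at the pole of
  \<open>m\<close>. At level \<open>n\<close> the constant term is a square, and the zero of
  \<open>m\<close> is used: for \<open>D = 2\<^bsup>n-1\<^esup>\<close> the Newton polygon of the
  polynomial there has a side from degree \<open>D\<close> to degree \<open>2 D\<close> of slope
  \<open>v(m) / D\<close>, because modulo \<open>m\<^sup>2\<close> and up to its constant term the
  polynomial is \<open>x\<^bsup>2D\<^esup> + 2 m x\<^bsup>D\<^esup>\<close> plus multiples of
  \<open>m\<close> in the degrees between. For odd \<open>v(m)\<close> such a side does not split
  evenly into the two conjugate factors \<open>h(x)\<close> and \<open>h(-x)\<close>.
\<close>
lemma irreducible_iterate:
  fixes m :: "'a::field" and v w :: "'a \<Rightarrow> int"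
  assumes v: "valued_field v" "v m > 0" "odd (v m)" "v 2 = 0"
    and w: "valued_field w" "w m < 0" "odd (w m)" "w 2 = 0"
    and m: "m \<noteq> 0" and two: "(2::'a) \<noteq> 0" and n: "n \<ge> 3"
  shows "irreducible (poly_iterate (quad m) n + [:m ^ 2 ^ (n - 1) - crit_orbit m n:])"
proof (rule ccontr)
  define \<gamma> where "\<gamma> = m ^ 2 ^ (n - 1) - crit_orbit m n"
  let ?g = "poly_iterate (quad m) n + [:\<gamma>:]"
  assume red: "\<not> irreducible (poly_iterate (quad m) n + [:m ^ 2 ^ (n - 1) - crit_orbit m n:])"
  define k where "k = n - 2"
  have k: "n = Suc (Suc k)" "k > 0" using n by (auto simp: k_def)
  define D where "D = (2::nat) ^ Suc k"
  have D: "D \<ge> 4" using power_increasing[of 2 "Suc k" "2::nat"] k(2) by (simp add: D_def)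
  interpret w: valued_field w by (rule w)
  have ns: "crit_orbit m i + \<gamma> \<noteq> y\<^sup>2 \<and> - (crit_orbit m i + \<gamma>) \<noteq> y\<^sup>2" if "1 \<le> i" "i < n" for i y
  proof -
    note * = w.critical_orbit_nonsquare_at_pole[OF w(2,3) m two w(4) n that, folded \<gamma>_def]
    have "even (w (y\<^sup>2))" if "y\<^sup>2 \<noteq> 0" using that by (simp add: w.power)
    with * show ?thesis by (metis w.minus neg_equal_0_iff_equal)
  qed
  let ?q = "pcompose (poly_iterate (quad m) (Suc k) + [:\<gamma>:]) [:m, 1:]"
  have irr: "irreducible (poly_iterate (quad m) (Suc k) + [:\<gamma>:])"
  proof (rule irreducible_iterate_plus_const[OF two])
    show "- (m + \<gamma>) \<noteq> y\<^sup>2" for y using ns[of 1 y] k by (simp add: poly_iterate_Suc)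
    show "crit_orbit m i + \<gamma> \<noteq> y\<^sup>2" if "2 \<le> i" "i \<le> Suc k" for i y using ns[of i y] k that by simp
  qed
  have g: "?g = pcompose ?q square_poly"
    unfolding k by (simp add: poly_iterate_Suc' pcompose_add pcompose_pCons flip: pcompose_assoc)
  have dq: "degree ?q = D" by (simp add: degree_pcompose degree_add_eq_left D_def)
  have "lead_coeff ?g = 1"
  proof -
    have "degree ?g = 2 ^ n" by (simp add: degree_add_eq_left)
    moreover have "coeff [:\<gamma>:] (2 ^ n) = 0" by (rule coeff_eq_0) simp
    moreover have "coeff (poly_iterate (quad m) n) (2 ^ n) = 1"
      using lead_coeff_poly_iterate_quad[of m n] by simp
    ultimately show ?thesis by (metis coeff_add add_0_right)
  qed
  then have "lead_coeff ?q = 1" unfolding g by (subst (asm) lead_coeff_comp) simp_all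
  with irreducible_pcompose_linear[OF irr] red obtain h where h: "lead_coeff h = 1" "degree h = D"
    "?g = smult ((-1) ^ D) (h * reflect h)"
    by (metis reducible_square_composition dq g \<gamma>_def)
  have gh: "h * reflect h = ?g" using h(3) by (simp add: D_def)
  interpret v: valued_field v by (rule v)
  obtain A B C where ABC: "v.integral_poly A" "v.integral_poly B" "v.integral_poly C"
    "poly_iterate (quad m) n = Polynomial.monom 1 (2 * D) + smult m B + smult (m\<^sup>2) C"
    "B = 1 + smult 2 (Polynomial.monom 1 D * A)" "coeff A 0 = 1"
    using v.iterate_mod_square[of m "Suc k"] v(2,4) two by (auto simp: v.ge_def k D_def)
  have m2: "v.ge (2 * v m) (m\<^sup>2 * coeff C j)" for j
    using v.ge_mult[of "2 * v m" "m\<^sup>2" 0 "coeff C j"] ABC(3) m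
    by (simp add: v.integral_poly_def v.ge_def v.power)
  have B: "v.ge (v m) (m * coeff B j)" for j
    using v.ge_mult[of "v m" "m" 0 "coeff B j"] ABC(2)
    by (simp add: v.integral_poly_def v.ge_def)
  have Bj: "coeff B j = (if j < D then 0 else 2 * coeff A (j - D))" if "j > 0" for j
    using that by (simp add: ABC(5) coeff_monom_mult)
  have gj: "coeff ?g j = m * coeff B j + m\<^sup>2 * coeff C j" if "j > 0" "j \<noteq> 2 * D" for j
    using that by (simp add: ABC(4) coeff_pCons split: nat.splits)
  have "even (v m)"
  proof (rule v.even_slope_if_product_with_reflection[OF h(2,1)])
    show "0 < D" "0 < v m" using D v by auto
    have "coeff ?g 0 = m ^ D" by (simp add: \<gamma>_def poly_0_coeff_0 D_def k)
    moreover have "2 * v m + 1 \<le> int D * v m"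
      using mult_right_mono[of 4 "int D" "v m"] D v(2) by linarith
    ultimately show "v.ge (2 * v m + 1) (coeff (h * reflect h) 0)"
      unfolding gh using m by (simp add: v.ge_def v.power)
    show "v.ge (2 * v m) (coeff (h * reflect h) j)" if "0 < j" "j < D" for j
      unfolding gh using gj[of j] Bj[of j] m2[of j] that by simp
    show "v.ge (v m) (coeff (h * reflect h) j)" if "D < j" "j < 2 * D" for j
      unfolding gh using gj[of j] B[of j] v.ge_mono[OF m2[of j], of "v m"] v(2) that
      by (auto intro: v.ge_add)
    have "coeff ?g D = 2 * m + m\<^sup>2 * coeff C D"
      using gj[of D] Bj[of D] D by (simp add: ABC(6))
    moreover have "2 * m \<noteq> 0" "v (2 * m) = v m" using two m v(4) by (simp_all add: v.mult)
    moreover have "v.ge (v m + 1) (m\<^sup>2 * coeff C D)"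
      using v.ge_mono[OF m2] v(2) by simp
    ultimately show "coeff (h * reflect h) D \<noteq> 0" "v (coeff (h * reflect h) D) = v m"
      unfolding gh using v.dominant_add[of "2 * m" "m\<^sup>2 * coeff C D"] by auto
  qed
  with v(3) show False by simp
qed

section \<open>The valuation of a prime\<close>

lemma carrier_of_type [simp]: "carrier ring_of_type_algebra = UNIV"
  and mult_of_type [simp]: "x \<otimes>\<^bsub>ring_of_type_algebra\<^esub> y = x * y"
  and add_of_type [simp]: "x \<oplus>\<^bsub>ring_of_type_algebra\<^esub> y = x + y"
  and one_of_type [simp]: "\<one>\<^bsub>ring_of_type_algebra\<^esub> = 1"
  and zero_of_type [simp]: "\<zero>\<^bsub>ring_of_type_algebra\<^esub> = 0"
  by (simp_all add: ring_of_type_algebra_def)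

lemma a_inv_of_type [simp]: "\<ominus>\<^bsub>ring_of_type_algebra\<^esub> (x::'a::comm_ring_1) = - x"
proof -
  interpret ring "ring_of_type_algebra :: 'a ring" ..
  show ?thesis by (intro add.inv_equality) auto
qed

lemma m_inv_of_type [simp]:
  assumes "(x::'a::field) \<noteq> 0" shows "inv\<^bsub>ring_of_type_algebra\<^esub> x = inverse x"
proof -
  interpret cring "ring_of_type_algebra :: 'a ring" ..
  show ?thesis using assms by (intro comm_inv_char) auto
qed

lemma nat_pow_of_type [simp]: "x [^]\<^bsub>ring_of_type_algebra\<^esub> (n::nat) = x ^ n" for x :: "'a::comm_ring_1"
proof -
  interpret ring "ring_of_type_algebra :: 'a ring" ..
  show ?thesis by (induction n) (simp_all add: mult.commute)
qed

lemma int_pow_of_type [simp]: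
  assumes "(x::'a::field) \<noteq> 0" shows "x [^]\<^bsub>ring_of_type_algebra\<^esub> (n::int) = x powi n"
  using assms by (simp add: int_pow_def2 power_int_def power_inverse)

lemma subring_of_type:
  assumes "subring R (ring_of_type_algebra :: 'a::comm_ring_1 ring)"
  shows "0 \<in> R" "1 \<in> R" "x \<in> R \<Longrightarrow> - x \<in> R" "x \<in> R \<Longrightarrow> y \<in> R \<Longrightarrow> x + y \<in> R"
    "x \<in> R \<Longrightarrow> y \<in> R \<Longrightarrow> x * y \<in> R" "x \<in> R \<Longrightarrow> y \<in> R \<Longrightarrow> x - y \<in> R"
    "x \<in> R \<Longrightarrow> x ^ n \<in> R"
proof -
  note S = subringE[OF assms, simplified]
  show *: "0 \<in> R" "1 \<in> R" "x \<in> R \<Longrightarrow> - x \<in> R" "x \<in> R \<Longrightarrow> y \<in> R \<Longrightarrow> x + y \<in> R"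
    "x \<in> R \<Longrightarrow> y \<in> R \<Longrightarrow> x * y \<in> R" for x y using S by auto
  show "x \<in> R \<Longrightarrow> y \<in> R \<Longrightarrow> x - y \<in> R" using *(4)[of x "- y"] *(3)[of y] by simp
  show "x \<in> R \<Longrightarrow> x ^ n \<in> R" by (induction n) (simp_all add: *)
qed

lemma Units_of_type:
  "Units ((ring_of_type_algebra :: 'a::field ring)\<lparr>carrier := R\<rparr>) = {u \<in> R. u \<noteq> 0 \<and> inverse u \<in> R}"
proof (intro equalityI subsetI)
  fix u assume "u \<in> Units ((ring_of_type_algebra :: 'a ring)\<lparr>carrier := R\<rparr>)"
  then obtain y where "u \<in> R" "y \<in> R" "u * y = 1" by (auto simp: Units_def)
  moreover from this have "inverse u = y" by (intro inverse_unique)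
  ultimately show "u \<in> {u \<in> R. u \<noteq> 0 \<and> inverse u \<in> R}" by auto
next
  fix u assume u: "u \<in> {u \<in> R. u \<noteq> 0 \<and> inverse u \<in> R}"
  then have "inverse u \<in> R" "inverse u * u = 1" "u * inverse u = 1" by auto
  with u show "u \<in> Units ((ring_of_type_algebra :: 'a ring)\<lparr>carrier := R\<rparr>)"
    unfolding Units_def by force
qed

text \<open>
  In a principal domain every irreducible element generates a maximal ideal. As there is only one,
  all irreducible elements are associated to a single \<open>\<pi>\<close>, and factorization into
  irreducibles gives the representation by units and powers of \<open>\<pi>\<close>.
\<close>
lemma prime_uniformizer:
  fixes R P k :: "'f::field set"
  assumes "prime_of ring_of_type_algebra k R P"
  obtains \<pi> where "\<pi> \<in> R" "\<pi> \<noteq> 0" "inverse \<pi> \<notin> R" "P = {r * \<pi> |r. r \<in> R}"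
    "\<And>x. x \<noteq> 0 \<Longrightarrow> \<exists>u n. u \<in> R \<and> u \<noteq> 0 \<and> inverse u \<in> R \<and> x = u * \<pi> powi n"
proof -
  define A where "A = (ring_of_type_algebra :: 'f ring)\<lparr>carrier := R\<rparr>"
  have R: "subring R (ring_of_type_algebra :: 'f ring)" and A: "principal_domain A" "\<not> field A"
    "\<exists>!M. maximalideal M A" and P: "maximalideal P A"
    and quot: "UNIV = {a * inv\<^bsub>ring_of_type_algebra\<^esub> b |a b. a \<in> R \<and> b \<in> R - {0::'f}}"
    using assms by (simp_all add: prime_of_def discrete_valuation_ring_def A_def)
  interpret A: principal_domain A by (rule A)
  interpret P: maximalideal P A by (rule P)
  note Rc = subring_of_type[OF R]
  have Asimps [simp]: "carrier A = R" "monoid.mult A = (*)" "\<one>\<^bsub>A\<^esub> = 1" "\<zero>\<^bsub>A\<^esub> = 0"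
    by (auto simp: A_def ring_of_type_algebra_def)
  have units: "Units A = {u \<in> R. u \<noteq> 0 \<and> inverse u \<in> R}"
    unfolding A_def by (rule Units_of_type)
  obtain \<pi> where \<pi>: "\<pi> \<in> R" "P = PIdl\<^bsub>A\<^esub> \<pi>" using A.exists_gen[OF P.is_ideal] by auto
  have P_eq: "P = {r * \<pi> |r. r \<in> R}" by (simp add: \<pi>(2) cgenideal_def)
  have "1 \<notin> P" using P.I_notcarr P.one_imp_carrier by auto
  then have not_unit: "inverse \<pi> \<notin> R" if "\<pi> \<noteq> 0" using that by (force simp: P_eq)
  have irr_assoc: "\<exists>u \<in> Units A. f = u * \<pi>" if f: "f \<in> R" "ring_irreducible\<^bsub>A\<^esub> f" for f
  proof -
    have "PIdl\<^bsub>A\<^esub> f = P" using A.irreducible_imp_maximalideal[of f] f A(3) P by auto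
    then have "f \<sim>\<^bsub>A\<^esub> \<pi>" using A.associated_iff_same_ideal f(1) \<pi> by auto
    then have "\<exists>u \<in> Units A. f = \<pi> \<otimes>\<^bsub>A\<^esub> u"
      using A.ring_associated_iff[of f \<pi>] f(1) \<pi> by (auto simp: mult.commute)
    then show ?thesis by (auto simp: mult.commute)
  qed
  have decomp: "\<exists>u n. u \<in> Units A \<and> a = u * \<pi> ^ n" if a: "a \<in> R" "a \<noteq> 0" for a
  proof (cases "a \<in> Units A")
    case True
    then show ?thesis by (intro exI[of _ a] exI[of _ 0]) auto
  next
    case False
    then obtain fs where fs: "set fs \<subseteq> carrier (mult_of A)" "wfactors (mult_of A) fs a"
      using A.factorization_property[of a] a by auto
    have "\<exists>u \<in> Units A. foldr (\<otimes>\<^bsub>mult_of A\<^esub>) fs \<one>\<^bsub>mult_of A\<^esub> = u * \<pi> ^ length fs"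
      using fs(1) wfactors_def[THEN iffD1, OF fs(2), THEN conjunct1]
    proof (induction fs)
      case Nil
      then show ?case by (auto intro!: bexI[of _ 1] simp: units Rc)
    next
      case (Cons f fs)
      then obtain u where u: "u \<in> Units A" "foldr (\<otimes>\<^bsub>mult_of A\<^esub>) fs \<one>\<^bsub>mult_of A\<^esub> = u * \<pi> ^ length fs" by auto
      have "ring_irreducible\<^bsub>A\<^esub> f" using Cons.prems A.ring_irreducibleI'[of f] by auto
      then obtain w where w: "w \<in> Units A" "f = w * \<pi>" using irr_assoc Cons.prems by auto
      have "w * u \<in> Units A" using u w A.Units_m_closed by auto
      then show ?case using u w by (intro bexI[of _ "w * u"]) auto
    qed
    then obtain u where u: "u \<in> Units A" "foldr (\<otimes>\<^bsub>mult_of A\<^esub>) fs \<one>\<^bsub>mult_of A\<^esub> = u * \<pi> ^ length fs" by blast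
    have c: "u * \<pi> ^ length fs \<in> R" using u Rc \<pi> by (auto simp: units)
    have "foldr (\<otimes>\<^bsub>mult_of A\<^esub>) fs \<one>\<^bsub>mult_of A\<^esub> \<sim>\<^bsub>mult_of A\<^esub> a"
      using fs(2) by (simp only: wfactors_def)
    then have "u * \<pi> ^ length fs \<sim>\<^bsub>mult_of A\<^esub> a" unfolding u(2) .
    then have "a \<sim>\<^bsub>mult_of A\<^esub> u * \<pi> ^ length fs" by (simp only: associated_def conj_commute)
    then have "a \<sim>\<^bsub>A\<^esub> u * \<pi> ^ length fs"
      using A.assoc_iff_assoc_mult[of a "u * \<pi> ^ length fs"] a(1) c by simp
    then obtain w where "w \<in> Units A" "a = w * (u * \<pi> ^ length fs)"
      using A.ring_associated_iff[of a "u * \<pi> ^ length fs"] a c by (auto simp: mult.commute)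
    moreover have "w * u \<in> Units A" using u \<open>w \<in> Units A\<close> A.Units_m_closed by auto
    ultimately show ?thesis by (intro exI[of _ "w * u"] exI[of _ "length fs"]) (auto simp: mult_ac)
  qed
  have \<pi>0: "\<pi> \<noteq> 0"
  proof
    assume "\<pi> = 0"
    then have "a \<in> Units A" if a: "a \<in> R" "a \<noteq> 0" for a
    proof -
      obtain u n where "u \<in> Units A" "a = u * 0 ^ n" using decomp[OF a] \<open>\<pi> = 0\<close> by blast
      then show ?thesis using a by (cases n) auto
    qed
    then have "field A" by (intro A.cring_fieldI) (auto simp: units)
    with A(2) show False by simp
  qed
  have "\<exists>u n. u \<in> R \<and> u \<noteq> 0 \<and> inverse u \<in> R \<and> x = u * \<pi> powi n" if "x \<noteq> 0" for x
  proof -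
    have "x \<in> {a * inv\<^bsub>ring_of_type_algebra\<^esub> b |a b. a \<in> R \<and> b \<in> R - {0::'f}}" using quot by blast
    then obtain a b where ab: "a \<in> R" "b \<in> R" "b \<noteq> 0" "x = a * inverse b" by auto
    with that have "a \<noteq> 0" by auto
    obtain u i where u: "u \<in> Units A" "a = u * \<pi> ^ i" using decomp ab \<open>a \<noteq> 0\<close> by blast
    obtain w j where w: "w \<in> Units A" "b = w * \<pi> ^ j" using decomp ab by blast
    have "x = (u * inverse w) * \<pi> powi (int i - int j)"
      using \<pi>0 by (simp add: ab(4) u w power_int_diff field_simps)
    then show ?thesis using u(1) w(1) Rc
      by (intro exI[of _ "u * inverse w"] exI[of _ "int i - int j"]) (auto simp: units)
  qed
  with \<pi>(1) \<pi>0 not_unit[OF \<pi>0] P_eq that show thesis by blast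
qed

text \<open>
  Any two generators of \<open>P\<close> differ by a unit, so the exponent in the definition of
  the valuation depends neither on the generator nor on the unit.
\<close>
lemma prime_valuation:
  fixes R P k :: "'f::field set"
  defines "v \<equiv> valuation ring_of_type_algebra R P"
  assumes prime: "prime_of ring_of_type_algebra k R P"
  shows "valued_field v" and "x \<in> R \<longleftrightarrow> 0 \<le> v x" and "x \<in> P \<longleftrightarrow> x = 0 \<or> 0 < v x"
    and "\<exists>\<pi>. \<pi> \<noteq> 0 \<and> \<pi> \<in> P"
proof -
  have R: "subring R (ring_of_type_algebra :: 'f ring)" using prime by (simp add: prime_of_def)
  note Rc = subring_of_type[OF R]
  obtain \<pi> where \<pi>: "\<pi> \<in> R" "\<pi> \<noteq> 0" "inverse \<pi> \<notin> R" "P = {r * \<pi> |r. r \<in> R}"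
    and decomp: "\<And>x. x \<noteq> 0 \<Longrightarrow> \<exists>u n. u \<in> R \<and> u \<noteq> 0 \<and> inverse u \<in> R \<and> x = u * \<pi> powi n"
    using that by (rule prime_uniformizer[OF prime])
  define U where "U = {u \<in> R. u \<noteq> 0 \<and> inverse u \<in> R}"
  have U_R: "U \<subseteq> R" by (auto simp: U_def)
  have U_mult: "u * w \<in> U" if "u \<in> U" "w \<in> U" for u w using that Rc by (auto simp: U_def)
  have U_inv: "inverse u \<in> U" if "u \<in> U" for u using that by (auto simp: U_def)
  have int_R: "u * \<pi> powi n \<in> R \<longleftrightarrow> 0 \<le> n" if u: "u \<in> U" for u n
  proof
    assume "0 \<le> n"
    then show "u * \<pi> powi n \<in> R" using u Rc \<pi>(1) by (auto simp: U_def power_int_def)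
  next
    assume *: "u * \<pi> powi n \<in> R"
    show "0 \<le> n"
    proof (rule ccontr)
      assume "\<not> 0 \<le> n"
      define j where "j = nat (- n - 1)"
      have n: "n = - 1 - int j" using \<open>\<not> 0 \<le> n\<close> by (simp add: j_def)
      have "inverse u * (u * \<pi> powi n) * \<pi> ^ j \<in> R" using u * Rc \<pi>(1) by (auto simp: U_def)
      moreover have "inverse u * (u * \<pi> powi n) * \<pi> ^ j = inverse \<pi>"
        using u \<pi>(2) by (simp add: n U_def power_int_diff field_simps)
      ultimately show False using \<pi>(3) by simp
    qed
  qed
  have PIdl: "PIdl\<^bsub>ring_of_type_algebra\<lparr>carrier := R\<rparr>\<^esub> a = {r * a |r. r \<in> R}" for a
    by (simp add: cgenideal_def)
  have units: "Units (ring_of_type_algebra\<lparr>carrier := R\<rparr>) = U"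
    unfolding U_def by (rule Units_of_type)
  have gen: "\<rho> \<noteq> 0 \<and> (\<exists>w \<in> U. \<rho> = w * \<pi>)" if \<rho>: "\<rho> \<in> R" "P = {r * \<rho> |r. r \<in> R}" for \<rho>
  proof -
    have "\<rho> \<in> P" using \<rho> Rc(2) by force
    then obtain r where r: "r \<in> R" "\<rho> = r * \<pi>" using \<pi>(4) by auto
    have "\<pi> \<in> P" using \<pi> Rc(2) by force
    then obtain s where s: "s \<in> R" "\<pi> = s * \<rho>" using \<rho>(2) by auto
    have "s * r = 1" using r s \<pi>(2) by (metis mult.assoc mult_cancel_right1)
    then have "inverse r = s" "r \<noteq> 0" by (metis inverse_unique mult.commute, auto)
    then show ?thesis using r s \<pi>(2) by (auto simp: U_def)
  qed
  have v: "v (u * \<pi> powi n) = n" if u: "u \<in> U" for u n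
  proof -
    let ?Q = "\<lambda>n'::int. \<exists>\<rho> w. \<rho> \<in> R \<and> P = PIdl\<^bsub>ring_of_type_algebra\<lparr>carrier := R\<rparr>\<^esub> \<rho> \<and>
        w \<in> Units (ring_of_type_algebra\<lparr>carrier := R\<rparr>) \<and>
        u * \<pi> powi n = w \<otimes>\<^bsub>ring_of_type_algebra\<^esub> \<rho> [^]\<^bsub>ring_of_type_algebra\<^esub> n'"
    have ne: "u * \<pi> powi n \<noteq> 0" using u \<pi>(2) by (auto simp: U_def)
    have "(THE n'. ?Q n') = n"
    proof (rule the_equality)
      show "?Q n" using \<pi> u by (intro exI[of _ \<pi>] exI[of _ u]) (auto simp: PIdl units)
    next
      fix n' assume "?Q n'"
      then obtain \<rho> w where \<rho>: "\<rho> \<in> R" "P = {r * \<rho> |r. r \<in> R}" "w \<in> U"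
        "u * \<pi> powi n = w \<otimes>\<^bsub>ring_of_type_algebra\<^esub> \<rho> [^]\<^bsub>ring_of_type_algebra\<^esub> n'"
        by (auto simp: PIdl units)
      obtain z where z: "\<rho> \<noteq> 0" "z \<in> U" "\<rho> = z * \<pi>" using gen[OF \<rho>(1,2)] by auto
      have zU: "z powi i \<in> U" for i
      proof -
        have "z ^ j \<in> U" for j using z(2) Rc by (auto simp: U_def power_inverse[symmetric])
        then show ?thesis using U_inv by (auto simp: power_int_def power_inverse)
      qed
      have eq: "u * \<pi> powi n = (w * z powi n') * \<pi> powi n'"
        using \<rho>(4) z by (simp add: power_int_mult_distrib mult.assoc)
      have w: "w * z powi n' \<in> U" using \<rho>(3) zU U_mult by blast
      have "u = (w * z powi n') * \<pi> powi (n' - n)" "w * z powi n' = u * \<pi> powi (n - n')"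
        using eq \<pi>(2) by (simp_all add: power_int_diff field_simps)
      then have "0 \<le> n' - n" "0 \<le> n - n'"
        using int_R[OF w, of "n' - n"] int_R[OF u, of "n - n'"] subsetD[OF U_R u] subsetD[OF U_R w] by metis+
      then show "n' = n" by simp
    qed
    then show ?thesis using ne by (simp add: v_def valuation_def)
  qed
  have ex: "\<exists>u \<in> U. x = u * \<pi> powi v x" if "x \<noteq> 0" for x
    using decomp[OF that] v by (force simp: U_def)
  have v0: "v 0 = 0" by (simp add: v_def valuation_def)
  show R_iff: "x \<in> R \<longleftrightarrow> 0 \<le> v x" for x
  proof (cases "x = 0")
    case False
    then obtain u where u: "u \<in> U" "x = u * \<pi> powi v x" using ex by blast
    show ?thesis using int_R[OF u(1), of "v x"] by (simp flip: u(2))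
  qed (simp add: v0 Rc)
  show "x \<in> P \<longleftrightarrow> x = 0 \<or> 0 < v x"
  proof (cases "x = 0")
    case True
    then show ?thesis using \<pi>(4) Rc(1) by force
  next
    case False
    then obtain u where u: "u \<in> U" "x = u * \<pi> powi v x" using ex by blast
    have "x \<in> P \<longleftrightarrow> x / \<pi> \<in> R" using \<pi>(2,4) by (auto simp: field_simps)
    also have "x / \<pi> = u * \<pi> powi (v x - 1)"
      using \<pi>(2) by (subst u(2)) (simp add: power_int_diff)
    also have "\<dots> \<in> R \<longleftrightarrow> 0 < v x" using int_R[OF u(1)] by simp
    finally show ?thesis using False by simp
  qed
  have v_mult: "v (x * y) = v x + v y" if xy: "x \<noteq> 0" "y \<noteq> 0" for x y
  proof -
    obtain a b where ab: "a \<in> U" "x = a * \<pi> powi v x" "b \<in> U" "y = b * \<pi> powi v y"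
      using ex[OF xy(1)] ex[OF xy(2)] by blast
    have "x * y = (a * b) * \<pi> powi (v x + v y)"
      using \<pi>(2) by (subst ab(2), subst ab(4)) (simp add: power_int_add mult_ac)
    then show ?thesis using v U_mult ab by simp
  qed
  have v_add: "v x \<le> v (x + y)" if "x \<noteq> 0" "y \<noteq> 0" "x + y \<noteq> 0" "v x \<le> v y" for x y
  proof -
    have inv: "v (inverse x) = - v x" using v_mult[of x "inverse x"] v[of 1 0] that Rc by (simp add: U_def)
    have "0 \<le> v (y * inverse x)" using v_mult[of y "inverse x"] inv that by simp
    then have "1 + y * inverse x \<in> R" using R_iff Rc by blast
    moreover have "x + y = x * (1 + y * inverse x)" using that by (simp add: field_simps)
    moreover from this that have "1 + y * inverse x \<noteq> 0" by auto
    ultimately show ?thesis using v_mult[of x "1 + y * inverse x"] R_iff that by simp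
  qed
  show "valued_field v"
  proof
    show "min (v x) (v y) \<le> v (x + y)" if "x \<noteq> 0" "y \<noteq> 0" "x + y \<noteq> 0" for x y
      using v_add[of x y] v_add[of y x] that by (auto simp: min_def add.commute)
  qed (rule v_mult)
  show "\<exists>\<pi>. \<pi> \<noteq> 0 \<and> \<pi> \<in> P" using \<pi> Rc(2) by force
qed

section \<open>Congruences modulo a prime ideal of a subring\<close>

lemma subring_of_typeI:
  fixes S :: "'a::comm_ring_1 set"
  assumes "1 \<in> S" "\<And>x. x \<in> S \<Longrightarrow> - x \<in> S" "\<And>x y. x \<in> S \<Longrightarrow> y \<in> S \<Longrightarrow> x * y \<in> S"
    "\<And>x y. x \<in> S \<Longrightarrow> y \<in> S \<Longrightarrow> x + y \<in> S"
  shows "subring S ring_of_type_algebra"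
proof -
  interpret ring "ring_of_type_algebra :: 'a ring" ..
  show ?thesis using assms by (intro subringI) auto
qed

definition polys_over :: "'a::comm_ring_1 set \<Rightarrow> 'a poly set" where
  "polys_over S = {p. \<forall>i. coeff p i \<in> S}"

context
  fixes S :: "'a::comm_ring_1 set"
  assumes S: "subring S ring_of_type_algebra"
begin

lemmas S_closed = subring_of_type[OF S]

lemma subring_sum: "(\<And>i. i \<in> A \<Longrightarrow> f i \<in> S) \<Longrightarrow> sum f A \<in> S"
  by (induction A rule: infinite_finite_induct) (auto intro: S_closed)

lemma subring_prod: "(\<And>i. i \<in> A \<Longrightarrow> f i \<in> S) \<Longrightarrow> prod f A \<in> S"
  by (induction A rule: infinite_finite_induct) (auto intro: S_closed)

lemma polys_over_pCons: "pCons c p \<in> polys_over S \<longleftrightarrow> c \<in> S \<and> p \<in> polys_over S"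
proof -
  have "(\<forall>i. coeff (pCons c p) i \<in> S) \<longleftrightarrow> c \<in> S \<and> (\<forall>i. coeff p i \<in> S)"
    by (metis coeff_pCons_0 coeff_pCons_Suc not0_implies_Suc)
  then show ?thesis by (simp add: polys_over_def)
qed

lemma polys_over_0: "0 \<in> polys_over S"
  by (simp add: polys_over_def S_closed)

lemma subring_polys_over: "subring (polys_over S) ring_of_type_algebra"
  by (rule subring_of_typeI)
     (auto simp: polys_over_def coeff_mult coeff_pCons one_pCons S_closed split: nat.splits
       intro!: subring_sum S_closed)

lemma polys_over_smult: "c \<in> S \<Longrightarrow> p \<in> polys_over S \<Longrightarrow> smult c p \<in> polys_over S"
  by (auto simp: polys_over_def S_closed)

lemma poly_in_subring: "p \<in> polys_over S \<Longrightarrow> x \<in> S \<Longrightarrow> poly p x \<in> S"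
  by (induction p) (auto simp: polys_over_pCons S_closed)

lemma synthetic_div_polys_over: "p \<in> polys_over S \<Longrightarrow> x \<in> S \<Longrightarrow> synthetic_div p x \<in> polys_over S"
  by (induction p) (auto simp: polys_over_pCons polys_over_0 poly_in_subring)

end

text \<open>
  Residue rings are handled as congruences in an ambient ring type. The same lemmas then apply to
  the residue field \<open>R / P\<close>, with ambient type \<open>'f\<close>, and to its
  extension \<open>R[x] / (p, P)\<close>, with ambient type \<open>'f poly\<close>; in the latter
  \<open>x \<mapsto> x\<^sup>q\<close> is additive for powers \<open>q\<close> of the
  characteristic before any reduction.
\<close>
locale subring_prime_ideal =
  fixes S I :: "'a::comm_ring_1 set"
  assumes S: "subring S ring_of_type_algebra"
    and I_subset: "I \<subseteq> S" and I_0: "0 \<in> I" and I_add: "x \<in> I \<Longrightarrow> y \<in> I \<Longrightarrow> x + y \<in> I"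
    and I_mult: "s \<in> S \<Longrightarrow> x \<in> I \<Longrightarrow> s * x \<in> I" and I_proper: "1 \<notin> I"
    and I_prime: "x \<in> S \<Longrightarrow> y \<in> S \<Longrightarrow> x * y \<in> I \<Longrightarrow> x \<in> I \<or> y \<in> I"
begin

lemmas closed = subring_of_type[OF S]

lemma I_minus: "x \<in> I \<Longrightarrow> - x \<in> I"
  using I_mult[of "-1" x] closed by simp

lemma I_minus_iff [simp]: "- x \<in> I \<longleftrightarrow> x \<in> I"
  using I_minus[of x] I_minus[of "- x"] by auto

lemma I_diff: "x \<in> I \<Longrightarrow> y \<in> I \<Longrightarrow> x - y \<in> I"
  using I_add[of x "- y"] I_minus[of y] by simp

lemma I_sum: "(\<And>i. i \<in> A \<Longrightarrow> f i \<in> I) \<Longrightarrow> sum f A \<in> I"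
  by (induction A rule: infinite_finite_induct) (auto intro: I_add I_0)

lemma I_swap: "x - y \<in> I \<Longrightarrow> y - x \<in> I"
  using I_minus[of "x - y"] by simp

lemma I_trans: "x - y \<in> I \<Longrightarrow> y - z \<in> I \<Longrightarrow> x - z \<in> I"
  using I_add[of "x - y" "y - z"] by simp

definition residue :: "'a \<Rightarrow> 'a set" where "residue x = {y. y - x \<in> I}"

lemma residue_eq_iff: "residue x = residue y \<longleftrightarrow> x - y \<in> I"
proof
  assume "residue x = residue y"
  moreover have "x \<in> residue x" by (simp add: residue_def I_0)
  ultimately have "x \<in> residue y" by simp
  then show "x - y \<in> I" by (simp add: residue_def)
next
  assume "x - y \<in> I"
  then have "z - x \<in> I \<longleftrightarrow> z - y \<in> I" for z using I_trans[of z x y] I_trans[of z y x] I_swap[of x y] by blast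
  then show "residue x = residue y" by (simp add: residue_def)
qed

lemma poly_cong:
  assumes "x \<in> S" "\<And>i. coeff p i - coeff q i \<in> I"
  shows "poly p x - poly q x \<in> I"
proof -
  have "poly (p - q) x \<in> I" if "\<And>i. coeff r i \<in> I" "r = p - q" for r
  proof -
    have "poly r x \<in> I" using that(1)
    proof (induction r)
      case (pCons c r)
      have "c \<in> I" "\<And>i. coeff r i \<in> I" using pCons.prems[of 0] pCons.prems[of "Suc _"] by auto
      with pCons.IH assms(1) show ?case by (auto intro: I_add I_mult)
    qed (simp add: I_0)
    with that show ?thesis by simp
  qed
  from this[of "p - q"] assms(2) show ?thesis by simp
qed

text \<open>
  After splitting off a linear factor \<open>X - b\<close> for one root \<open>b\<close>, every
  root incongruent to \<open>b\<close> is a root of the quotient, because the ideal is prime.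
\<close>
lemma card_incongruent_roots:
  assumes "g \<in> polys_over S" "\<exists>i. coeff g i \<notin> I" "T \<subseteq> S" "\<And>a. a \<in> T \<Longrightarrow> poly g a \<in> I"
    and "inj_on residue T"
  shows "finite T \<and> card T \<le> degree g"
  using assms
proof (induction "degree g" arbitrary: g T)
  case 0
  then obtain c where c: "g = [:c:]" using degree_eq_zeroE by metis
  have "c \<notin> I"
  proof
    assume "c \<in> I"
    then have "coeff g i \<in> I" for i using I_0 by (cases i) (auto simp: c)
    with 0(3) show False by blast
  qed
  then have "T = {}" using 0(5) c by auto
  then show ?case by simp
next
  case (Suc d)
  show ?case
  proof (cases "T = {}")
    case False
    then obtain b where b: "b \<in> T" by blast
    define h where "h = synthetic_div g b"
    have bS: "b \<in> S" using b Suc.prems(3) by auto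
    have g: "g = [:- b, 1:] * h + [:poly g b:]"
      using synthetic_div_correct'[of b g] by (simp add: h_def add.commute)
    have hS: "h \<in> polys_over S" unfolding h_def by (rule synthetic_div_polys_over[OF S Suc.prems(1) bS])
    have deg: "degree h = d" using Suc(2) by (simp add: h_def degree_synthetic_div)
    have "\<exists>i. coeff h i \<notin> I"
    proof (rule ccontr)
      assume *: "\<nexists>i. coeff h i \<notin> I"
      have "coeff g i \<in> I" for i
      proof -
        have "coeff g i = coeff (pCons 0 h) i - b * coeff h i + coeff [:poly g b:] i"
          by (subst g) (simp add: algebra_simps flip: coeff_add)
        moreover have "coeff (pCons 0 h) i \<in> I" "coeff [:poly g b:] i \<in> I"
          using * Suc.prems(4)[OF b] I_0 by (auto simp: coeff_pCons split: nat.splits)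
        ultimately show ?thesis using * bS by (auto intro!: I_add I_diff I_mult)
      qed
      with Suc.prems(2) show False by blast
    qed
    moreover have "poly h a \<in> I" if a: "a \<in> T - {b}" for a
    proof -
      have aS: "a \<in> S" using a Suc.prems(3) by auto
      have "poly g a = (a - b) * poly h a + poly g b" by (subst g) (simp add: algebra_simps)
      then have "(a - b) * poly h a = poly g a - poly g b" by simp
      also have "\<dots> \<in> I" using Suc.prems(4) a b by (intro I_diff) auto
      finally have "a - b \<in> I \<or> poly h a \<in> I"
        using aS bS poly_in_subring[OF S hS] closed by (intro I_prime) auto
      moreover have "a - b \<notin> I"
        using inj_onD[OF Suc.prems(5), of a b] a b residue_eq_iff by auto
      ultimately show ?thesis by blast
    qed
    moreover have "inj_on residue (T - {b})" using Suc.prems(5) by (rule inj_on_subset) auto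
    ultimately have "finite (T - {b}) \<and> card (T - {b}) \<le> d"
      using Suc(1)[of h "T - {b}"] deg hS Suc.prems(3) by blast
    then show ?thesis using Suc(2) card_Suc_Diff1[OF _ b] by auto
  qed simp
qed

lemma finite_residues_of_roots:
  assumes "g \<in> polys_over S" "\<exists>i. coeff g i \<notin> I"
  shows "finite (residue ` {a \<in> S. poly g a \<in> I})"
proof -
  let ?X = "{a \<in> S. poly g a \<in> I}"
  have "\<exists>T \<subseteq> ?X. inj_on residue T \<and> residue ` ?X = residue ` T"
    by (rule subset_image_inj[THEN iffD1]) simp
  then obtain T where T: "T \<subseteq> ?X" "inj_on residue T" "residue ` ?X = residue ` T" by auto
  have "finite T" using card_incongruent_roots[OF assms, of T] T by auto
  with T(3) show ?thesis by simp
qed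

text \<open>A reduction of the residue ring is finite as soon as its elements satisfy nontrivial equations
  of bounded degree whose coefficients represent only finitely many residues.\<close>
lemma finite_residues_if_bounded_degree:
  assumes C: "C \<subseteq> S" "finite (residue ` C)"
    and rel: "\<And>a. a \<in> S \<Longrightarrow> \<exists>g \<in> polys_over C. degree g \<le> N \<and> (\<exists>i. coeff g i \<notin> I) \<and> poly g a \<in> I"
  shows "finite (residue ` S)"
proof -
  obtain B where B: "B \<subseteq> C" "finite B" "residue ` C = residue ` B"
    using finite_subset_image[OF C(2) subset_refl] by blast
  define G where "G = {g. (\<exists>xs. g = Poly xs \<and> set xs \<subseteq> B \<and> length xs \<le> Suc N) \<and> (\<exists>i. coeff g i \<notin> I)}"
  have "finite G"
  proof (rule finite_subset)
    show "G \<subseteq> Poly ` {xs. set xs \<subseteq> B \<and> length xs \<le> Suc N}" by (auto simp: G_def)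
  qed (use B(2) in \<open>simp add: finite_lists_length_le\<close>)
  moreover have G_S: "g \<in> polys_over S" if "g \<in> G" for g
    using that B(1) C(1) closed(1)
    by (auto simp: G_def polys_over_def nth_default_def coeff_Poly_eq) (meson nth_mem subset_iff)
  moreover have "residue ` S \<subseteq> (\<Union>g\<in>G. residue ` {a \<in> S. poly g a \<in> I})"
  proof clarify
    fix a assume a: "a \<in> S"
    from rel[OF a] obtain g i where g: "g \<in> polys_over C" "degree g \<le> N" "coeff g i \<notin> I" "poly g a \<in> I" by blast
    have "\<forall>c \<in> C. \<exists>b \<in> B. c - b \<in> I" using B(3) residue_eq_iff by (metis imageE imageI)
    then obtain r where r: "\<And>c. c \<in> C \<Longrightarrow> r c \<in> B" "\<And>c. c \<in> C \<Longrightarrow> c - r c \<in> I" by metis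
    define g' where "g' = Poly (map (\<lambda>i. r (coeff g i)) [0..<Suc N])"
    have gC: "coeff g j \<in> C" for j using g(1) by (simp add: polys_over_def)
    have cong: "coeff g j - coeff g' j \<in> I" for j
    proof (cases "j \<le> N")
      case True
      then show ?thesis using r(2)[OF gC] by (simp add: g'_def coeff_Poly_eq nth_default_def del: upt_Suc)
    next
      case False
      then show ?thesis using g(2) I_0
        by (simp add: g'_def coeff_Poly_eq nth_default_def coeff_eq_0 del: upt_Suc)
    qed
    have "coeff g' i \<notin> I" using cong[of i] g(3) I_add[of "coeff g i - coeff g' i" "coeff g' i"] by auto
    moreover have "set (map (\<lambda>i. r (coeff g i)) [0..<Suc N]) \<subseteq> B" using r(1) gC by auto
    ultimately have "g' \<in> G" unfolding G_def g'_def
      by (intro CollectI conjI exI[of _ "map (\<lambda>i. r (coeff g i)) [0..<Suc N]"]) (auto simp del: upt_Suc)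
    moreover have "poly g' a \<in> I"
      using poly_cong[OF a, of g g'] cong I_diff[OF g(4), of "poly g a - poly g' a"] by simp
    ultimately show "residue a \<in> (\<Union>g\<in>G. residue ` {a \<in> S. poly g a \<in> I})" using a by blast
  qed
  ultimately show ?thesis
    using finite_residues_of_roots by (elim finite_subset) (auto simp: G_def)
qed

end

lemma subring_prime_ideal_prime_of:
  assumes prime: "prime_of ring_of_type_algebra k R P"
  shows "subring_prime_ideal R (P :: 'f::field set)"
proof -
  let ?v = "valuation ring_of_type_algebra R P"
  interpret valued_field ?v by (rule prime_valuation(1)[OF prime])
  note R = prime_valuation(2)[OF prime] and P = prime_valuation(3)[OF prime]
  show ?thesis
  proof (unfold subring_prime_ideal_def, intro conjI allI impI)
    show "subring R (ring_of_type_algebra :: 'f ring)" using prime by (simp add: prime_of_def)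
    then have R0: "0 \<in> R" by (rule subring_of_type)
    have P_ge: "x \<in> P \<longleftrightarrow> ge 1 x" "x \<in> R \<longleftrightarrow> ge 0 x" for x using P[of x] R[of x] R0 by (auto simp: ge_def)
    show "P \<subseteq> R" using ge_mono[of 1 _ 0] by (auto simp: P_ge)
    show "0 \<in> P" "1 \<notin> P" by (simp_all add: P)
    show "x \<in> P \<Longrightarrow> y \<in> P \<Longrightarrow> x + y \<in> P" for x y by (simp add: P_ge ge_add)
    show "s \<in> R \<Longrightarrow> x \<in> P \<Longrightarrow> s * x \<in> P" for s x using ge_mult[of 0 s 1 x] by (simp add: P_ge)
    show "x \<in> R \<Longrightarrow> y \<in> R \<Longrightarrow> x * y \<in> P \<Longrightarrow> x \<in> P \<or> y \<in> P" for x y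
      using mult[of x y] by (cases "x = 0 \<or> y = 0") (auto simp: P_ge ge_def)
  qed
qed

section \<open>Finiteness of the residue field\<close>

lemma finite_bounded_polys:
  fixes K :: "'a::comm_ring_1 set"
  assumes "finite K"
  shows "finite {p \<in> polys_over K. degree p < d}"
proof (rule finite_subset)
  show "{p \<in> polys_over K. degree p < d} \<subseteq> Poly ` {xs. set xs \<subseteq> K \<and> length xs \<le> d}"
  proof
    fix p assume p: "p \<in> {p \<in> polys_over K. degree p < d}"
    have "set (coeffs p) \<subseteq> K" using p by (auto simp: polys_over_def coeffs_def split: if_splits)
    moreover have "length (coeffs p) \<le> d" using p by (cases "p = 0") (auto simp: length_coeffs_degree)
    ultimately show "p \<in> Poly ` {xs. set xs \<subseteq> K \<and> length xs \<le> d}"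
      by (intro image_eqI[of _ _ "coeffs p"]) auto
  qed
qed (use assms in \<open>simp add: finite_lists_length_le\<close>)

lemma subring_poly_values:
  fixes k :: "'a::comm_ring_1 set"
  assumes k: "subring k ring_of_type_algebra"
  shows "subring ((\<lambda>r. poly r s) ` polys_over k) ring_of_type_algebra"
proof (rule subring_of_typeI)
  note pc = subring_of_type[OF subring_polys_over[OF k]]
  let ?C = "(\<lambda>r. poly r s) ` polys_over k"
  show "1 \<in> ?C" using pc(2) by (auto intro!: image_eqI[of _ _ 1])
  show "x \<in> ?C \<Longrightarrow> - x \<in> ?C" for x using pc(3) by (auto intro!: image_eqI[of _ _ "- _"])
  show "x \<in> ?C \<Longrightarrow> y \<in> ?C \<Longrightarrow> x * y \<in> ?C" "x \<in> ?C \<Longrightarrow> y \<in> ?C \<Longrightarrow> x + y \<in> ?C" for x y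
    using pc(4,5) by (auto intro: image_eqI[of _ _ "_ * _"] image_eqI[of _ _ "_ + _"])
qed

lemma polys_over_division:
  fixes k :: "'a::field set"
  assumes k: "subring k ring_of_type_algebra" "\<And>c. c \<in> k \<Longrightarrow> inverse c \<in> k"
    and p: "p \<in> polys_over k" "p \<noteq> 0" and r: "r \<in> polys_over k"
  obtains q s where "q \<in> polys_over k" "s \<in> polys_over k" "r = p * q + s" "s = 0 \<or> degree s < degree p"
proof -
  note kc = subring_of_type[OF k(1)]
  note pc = subring_of_type[OF subring_polys_over[OF k(1)]]
  have "\<exists>q s. q \<in> polys_over k \<and> s \<in> polys_over k \<and> r = p * q + s \<and> (s = 0 \<or> degree s < degree p)"
    using r
  proof (induction r)
    case 0
    show ?case by (rule exI[of _ 0], rule exI[of _ 0]) (simp add: pc)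
  next
    case (pCons c r)
    then have c: "c \<in> k" and "r \<in> polys_over k" using polys_over_pCons[OF k(1)] by auto
    with pCons.IH obtain q s where qs: "q \<in> polys_over k" "s \<in> polys_over k" "r = p * q + s"
      "s = 0 \<or> degree s < degree p" by blast
    define u where "u = pCons c s"
    define e where "e = coeff u (degree p) / lead_coeff p"
    have u: "u \<in> polys_over k" "degree u \<le> degree p"
      using qs c polys_over_pCons[OF k(1)] by (auto simp: u_def)
    have "coeff u (degree p) \<in> k" "lead_coeff p \<in> k" using u p by (auto simp: polys_over_def)
    then have "e \<in> k" using k(2) kc by (simp add: e_def divide_inverse)
    define w where "w = u - smult e p"
    have w: "w \<in> polys_over k"
      unfolding w_def using u p \<open>e \<in> k\<close> by (intro pc polys_over_smult[OF k(1)])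
    have "degree w \<le> degree p" unfolding w_def using u(2) by (intro degree_diff_le) auto
    moreover have "coeff w (degree p) = 0" using p(2) by (simp add: w_def e_def)
    ultimately have dw: "w = 0 \<or> degree w < degree p"
      by (metis eq_zero_or_degree_less)
    have "pCons c r = p * (pCons e q) + w"
      by (simp add: w_def u_def qs(3) algebra_simps) 
    moreover have "pCons e q \<in> polys_over k" using qs(1) \<open>e \<in> k\<close> polys_over_pCons[OF k(1)] by auto
    ultimately show ?case using w dw by blast
  qed
  with that show thesis by blast
qed

lemma combine_powers:
  fixes a :: "'a::comm_ring_1"
  shows "ring.combine ring_of_type_algebra Ks (map (\<lambda>i. a ^ i) [j..<j + length Ks]) = a ^ j * poly (Poly Ks) a"
proof -
  interpret ring "ring_of_type_algebra :: 'a ring" ..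
  show ?thesis
  proof (induction Ks arbitrary: j)
    case (Cons c Ks)
    have "[j..<j + length (c # Ks)] = j # [Suc j..<Suc j + length Ks]" by (simp add: upt_rec)
    then show ?case using Cons[of "Suc j"] by (simp add: algebra_simps)
  qed simp
qed

lemma bounded_algebraic_relation:
  fixes K :: "'a::field set"
  assumes K: "subfield K ring_of_type_algebra"
    and fin: "ring.finite_dimension ring_of_type_algebra K (UNIV :: 'a set)"
  obtains N where "\<And>a. \<exists>g \<in> polys_over K. g \<noteq> 0 \<and> degree g \<le> N \<and> poly g a = 0"
proof -
  interpret ring "ring_of_type_algebra :: 'a ring" ..
  obtain N where N: "dimension N K (UNIV :: 'a set)" using fin by (auto simp: finite_dimension_def)
  have "\<exists>g \<in> polys_over K. g \<noteq> 0 \<and> degree g \<le> N \<and> poly g a = 0" for a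
  proof -
    let ?Us = "map (\<lambda>i. a ^ i) [0..<Suc N]"
    have "dependent K ?Us"
      using independent_length_le_dimension[OF K N, of ?Us] by auto
    then obtain Ks where Ks: "length Ks = length ?Us" "combine Ks ?Us = 0" "set Ks \<subseteq> K" "set Ks \<noteq> {0}"
      using dependent_imp_non_trivial_combine[OF K, of ?Us] by auto
    have K0: "0 \<in> K" using subring_of_type(1)[OF subfieldE(1)[OF K]] .
    have "Poly Ks \<in> polys_over K"
      using Ks(3) K0 by (auto simp: polys_over_def coeff_Poly_eq nth_default_def)
    moreover have "Poly Ks \<noteq> 0"
    proof
      assume *: "Poly Ks = 0"
      have "x = 0" if "x \<in> set Ks" for x
        using that * by (auto simp: in_set_conv_nth) (metis coeff_0 coeff_Poly_eq nth_default_nth)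
      then have "set Ks \<subseteq> {0}" by auto
      moreover have "set Ks \<noteq> {}" using Ks(1) by auto
      ultimately show False using Ks(4) subset_singletonD by metis
    qed
    moreover have "degree (Poly Ks) \<le> N"
      using Ks(1) degree_Poly[of Ks] by (auto intro: degree_le simp: coeff_Poly_eq nth_default_def)
    moreover have "poly (Poly Ks) a = 0"
      using combine_powers[of Ks a 0] Ks(1,2) by simp
    ultimately show ?thesis by blast
  qed
  with that show thesis by blast
qed

definition fractions :: "'a::field set \<Rightarrow> 'a set" where
  "fractions C = {c / d |c d. c \<in> C \<and> d \<in> C \<and> d \<noteq> 0}"

lemma generate_field_subset_fractions:
  fixes C :: "'a::field set"
  assumes C: "subring C ring_of_type_algebra" and H: "H \<subseteq> fractions C"
  shows "generate_field ring_of_type_algebra H \<subseteq> fractions C"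
proof
  note Cc = subring_of_type[OF C]
  fix x assume "x \<in> generate_field ring_of_type_algebra H"
  then show "x \<in> fractions C"
  proof induction
    case one
    show ?case unfolding fractions_def using Cc by (intro CollectI exI[of _ 1]) auto
  next
    case (a_inv h)
    then obtain c d where h: "h = c / d" "c \<in> C" "d \<in> C" "d \<noteq> 0" by (auto simp: fractions_def)
    then have "- h = (- c) / d" by simp
    with h Cc show ?case unfolding fractions_def a_inv_of_type by blast
  next
    case (m_inv h)
    then obtain c d where h: "h = c / d" "c \<in> C" "d \<in> C" "d \<noteq> 0" by (auto simp: fractions_def)
    with m_inv have "inverse h = d / c" "c \<noteq> 0" by auto
    with h m_inv show ?case unfolding fractions_def by auto
  next
    case (eng_add x y)
    then obtain c d c' d' where h: "x = c / d" "c \<in> C" "d \<in> C" "d \<noteq> 0" "y = c' / d'" "c' \<in> C" "d' \<in> C" "d' \<noteq> 0"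
      by (auto simp: fractions_def)
    then have "x + y = (c * d' + c' * d) / (d * d')" by (simp add: field_simps)
    moreover have "c * d' + c' * d \<in> C" "d * d' \<in> C" "d * d' \<noteq> 0" using h Cc by auto
    ultimately show ?case unfolding fractions_def add_of_type by blast
  next
    case (eng_mult x y)
    then obtain c d c' d' where h: "x = c / d" "c \<in> C" "d \<in> C" "d \<noteq> 0" "y = c' / d'" "c' \<in> C" "d' \<in> C" "d' \<noteq> 0"
      by (auto simp: fractions_def)
    then have "x * y = (c * c') / (d * d')" by simp
    moreover have "c * c' \<in> C" "d * d' \<in> C" "d * d' \<noteq> 0" using h Cc by auto
    ultimately show ?case unfolding fractions_def mult_of_type by blast
  qed (use H in auto)
qed

lemma clear_denominators:
  fixes C :: "'a::field set"
  assumes C: "subring C ring_of_type_algebra" and g: "g \<in> polys_over (fractions C)"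
  shows "\<exists>d \<in> C. d \<noteq> 0 \<and> smult d g \<in> polys_over C"
  using g
proof (induction g)
  case 0
  show ?case using subring_of_type[OF C] by (intro bexI[of _ 1]) (auto simp: polys_over_def)
next
  case (pCons c g)
  note Cc = subring_of_type[OF C]
  have cf: "coeff (pCons c g) i \<in> fractions C" for i using pCons.prems by (simp add: polys_over_def)
  have "coeff g i \<in> fractions C" for i using cf[of "Suc i"] by simp
  then have "g \<in> polys_over (fractions C)" by (simp add: polys_over_def)
  with pCons.IH obtain d where d: "d \<in> C" "d \<noteq> 0" "smult d g \<in> polys_over C" by blast
  obtain e f where e: "c = e / f" "e \<in> C" "f \<in> C" "f \<noteq> 0" using cf[of 0] by (auto simp: fractions_def)
  have "smult (f * d) (pCons c g) = pCons (d * e) (smult f (smult d g))" using e by (simp add: mult_ac)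
  moreover have "pCons (d * e) (smult f (smult d g)) \<in> polys_over C"
    using d e Cc polys_over_smult[OF C e(3) d(3)] polys_over_pCons[OF C] by auto
  ultimately show ?case using d e Cc by (intro bexI[of _ "f * d"]) auto
qed

text \<open>
  Let \<open>F\<close> be algebraic of bounded degree over the fractions of a ring \<open>C\<close> of polynomials over a finite
  field in an element of \<open>R\<close>.  A nonzero element of \<open>P\<close> has an equation over \<open>C\<close> of minimal degree,
  whose constant term is then a nonzero element of \<open>P \<inter> C\<close>; division by one of least degree shows
  that \<open>C\<close> has finitely many residues.  An equation over \<open>C\<close> for an element of \<open>R\<close> can be divided by
  that element until not all its coefficients lie in \<open>P\<close>, so it survives modulo \<open>P\<close>.
\<close>
lemma finite_residues_over_polynomial_subring:
  fixes k R P :: "'f::field set"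
  assumes prime: "prime_of ring_of_type_algebra k R P"
    and k: "subring k ring_of_type_algebra" "\<And>c. c \<in> k \<Longrightarrow> inverse c \<in> k" "finite k"
    and s: "s \<in> R" and C_def: "C = (\<lambda>r. poly r s) ` polys_over k"
    and rel: "\<And>a. \<exists>g \<in> polys_over C. g \<noteq> 0 \<and> degree g \<le> N \<and> poly g a = 0"
  shows "finite (subring_prime_ideal.residue P ` R)"
proof -
  let ?v = "valuation ring_of_type_algebra R P"
  interpret v: valued_field ?v by (rule prime_valuation(1)[OF prime])
  note R = prime_valuation(2)[OF prime] and P = prime_valuation(3)[OF prime]
  interpret subring_prime_ideal R P by (rule subring_prime_ideal_prime_of[OF prime])
  have kR: "k \<subseteq> R" using prime by (simp add: prime_of_def)
  note kc = subring_of_type[OF k(1)]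
  have pk: "subring (polys_over k) ring_of_type_algebra" by (rule subring_polys_over[OF k(1)])
  note pc = subring_of_type[OF pk]
  have CR: "C \<subseteq> R"
  proof -
    have "polys_over k \<subseteq> polys_over R" using kR by (auto simp: polys_over_def)
    then show ?thesis using poly_in_subring[OF S _ s] by (auto simp: C_def)
  qed
  have C: "subring C ring_of_type_algebra"
    unfolding C_def by (rule subring_poly_values) fact
  have "\<exists>p0 \<in> C. p0 \<noteq> 0 \<and> p0 \<in> P"
  proof -
    obtain \<pi> where \<pi>: "\<pi> \<noteq> 0" "\<pi> \<in> P" using prime_valuation(4)[OF prime] by blast
    define Q where "Q g \<longleftrightarrow> g \<in> polys_over C \<and> g \<noteq> 0 \<and> poly g \<pi> = 0" for g
    have "\<exists>g. Q g" using rel[of \<pi>] by (auto simp: Q_def)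
    then obtain g where g: "Q g" "\<And>h. Q h \<Longrightarrow> degree g \<le> degree h"
      using ex_has_least_nat[of Q _ degree] by metis
    obtain c h where h: "g = pCons c h" by (cases g)
    have hC: "c \<in> C" "h \<in> polys_over C" using g(1) polys_over_pCons[OF C] by (auto simp: Q_def h)
    have "c \<noteq> 0"
    proof
      assume "c = 0"
      then have "Q h" "h \<noteq> 0" using g(1) hC \<pi> by (auto simp: Q_def h)
      with g(2)[of h] show False by (simp add: h)
    qed
    moreover have "poly h \<pi> \<in> R"
      using hC CR \<pi> I_subset by (intro poly_in_subring[OF S]) (auto simp: polys_over_def)
    then have "- (poly h \<pi> * \<pi>) \<in> P" using I_mult \<pi> I_minus by blast
    moreover have "c = - (poly h \<pi> * \<pi>)" using g(1) by (simp add: Q_def h eq_neg_iff_add_eq_0 mult.commute)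
    ultimately have "c \<noteq> 0" "c \<in> P" by simp_all
    with hC(1) show ?thesis by blast
  qed
  then obtain r0 where r0: "r0 \<in> polys_over k" "poly r0 s \<noteq> 0" "poly r0 s \<in> P" by (auto simp: C_def)
  define Q where "Q r \<longleftrightarrow> r \<in> polys_over k \<and> poly r s \<noteq> 0 \<and> poly r s \<in> P" for r
  have "\<exists>p. Q p \<and> (\<forall>r. Q r \<longrightarrow> degree p \<le> degree r)"
    using ex_has_least_nat[of Q r0 degree] r0 by (auto simp: Q_def)
  then obtain p where p: "Q p" "\<And>r. Q r \<Longrightarrow> degree p \<le> degree r" by blast
  have p': "p \<in> polys_over k" "p \<noteq> 0" "poly p s \<in> P" "poly p s \<noteq> 0" using p(1) by (auto simp: Q_def)
  have divide: "\<exists>q s'. q \<in> polys_over k \<and> s' \<in> polys_over k \<and> r = p * q + s' \<and> (s' = 0 \<or> degree s' < degree p)"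
    if "r \<in> polys_over k" for r
    using polys_over_division[OF k(1,2) p'(1,2) that] by metis
  have "finite (residue ` C)"
  proof (rule finite_subset)
    let ?B = "{r \<in> polys_over k. degree r < Suc (degree p)}"
    show "finite ((\<lambda>r. residue (poly r s)) ` ?B)" using finite_bounded_polys[OF k(3)] by simp
    show "residue ` C \<subseteq> (\<lambda>r. residue (poly r s)) ` ?B"
    proof
      fix Y assume "Y \<in> residue ` C"
      then obtain r where r: "r \<in> polys_over k" "Y = residue (poly r s)" by (auto simp: C_def)
      obtain q s' where qs: "q \<in> polys_over k" "s' \<in> polys_over k" "r = p * q + s'" "s' = 0 \<or> degree s' < degree p"
        using divide[OF r(1)] by blast
      have "poly q s \<in> R" using qs(1) CR by (auto simp: C_def)
      then have "poly q s * poly p s \<in> P" using I_mult p'(3) by blast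
      moreover have "poly r s - poly s' s = poly q s * poly p s" by (simp add: qs(3))
      ultimately have "Y = residue (poly s' s)" unfolding r(2) residue_eq_iff by metis
      moreover have "s' \<in> ?B" using qs by auto
      ultimately show "Y \<in> (\<lambda>r. residue (poly r s)) ` ?B" by blast
    qed
  qed
  moreover have divC: "\<exists>c' \<in> C. c = poly p s * c'" if c: "c \<in> C" "c \<in> P" for c
  proof -
    obtain r where r: "r \<in> polys_over k" "c = poly r s" using c(1) by (auto simp: C_def)
    obtain q s' where qs: "q \<in> polys_over k" "s' \<in> polys_over k" "r = p * q + s'" "s' = 0 \<or> degree s' < degree p"
      using divide[OF r(1)] by blast
    have "poly q s \<in> R" using qs(1) CR by (auto simp: C_def)
    then have "poly q s * poly p s \<in> P" using I_mult p'(3) by blast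
    moreover have "poly s' s = poly r s - poly q s * poly p s" by (simp add: qs(3))
    ultimately have "poly s' s \<in> P" using I_diff c(2) r(2) by metis
    have "poly s' s = 0"
    proof (rule ccontr)
      assume "poly s' s \<noteq> 0"
      with \<open>poly s' s \<in> P\<close> qs(2) have "Q s'" "s' \<noteq> 0" by (auto simp: Q_def)
      with p(2)[of s'] qs(4) show False by auto
    qed
    then have "c = poly p s * poly q s" by (simp add: r(2) qs(3))
    then show ?thesis using qs(1) by (auto simp: C_def)
  qed
  have "\<exists>g \<in> polys_over C. degree g \<le> N \<and> (\<exists>i. coeff g i \<notin> P) \<and> poly g a \<in> P" for a
  proof -
    define M where "M g \<longleftrightarrow> g \<in> polys_over C \<and> g \<noteq> 0 \<and> degree g \<le> N \<and> poly g a = 0" for g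
    obtain g0 where "M g0" using rel[of a] by (auto simp: M_def)
    then have "\<exists>g. M g \<and> (\<forall>h. M h \<longrightarrow> nat (?v (lead_coeff g)) \<le> nat (?v (lead_coeff h)))"
      using ex_has_least_nat[of M g0 "\<lambda>g. nat (?v (lead_coeff g))"] by auto
    then obtain g where g: "M g" "\<And>h. M h \<Longrightarrow> nat (?v (lead_coeff g)) \<le> nat (?v (lead_coeff h))" by blast
    have "\<exists>i. coeff g i \<notin> P"
    proof (rule ccontr)
      assume "\<nexists>i. coeff g i \<notin> P"
      then have all: "\<exists>c' \<in> C. coeff g i = poly p s * c'" for i
        using g(1) by (intro divC) (auto simp: M_def polys_over_def)
      define h where "h = smult (inverse (poly p s)) g"
      have gh: "g = smult (poly p s) h" using p'(4) by (simp add: h_def)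
      have "coeff h i \<in> C" for i using all[of i] p'(4) by (auto simp: h_def mult.assoc[symmetric])
      moreover have "h \<noteq> 0" using g(1) by (auto simp: gh M_def)
      ultimately have "M h" using g(1) p'(4) by (auto simp: gh M_def polys_over_def)
      have lc: "lead_coeff h \<noteq> 0" "0 \<le> ?v (lead_coeff h)"
        using \<open>h \<noteq> 0\<close> \<open>\<And>i. coeff h i \<in> C\<close> CR R by auto
      have "?v (lead_coeff g) = ?v (poly p s) + ?v (lead_coeff h)"
        using v.mult[OF p'(4) lc(1)] p'(4) by (simp add: gh)
      moreover have "0 < ?v (poly p s)" using P p'(3,4) by blast
      ultimately show False using g(2)[OF \<open>M h\<close>] lc(2) by auto
    qed
    then show ?thesis using g(1) I_0 by (auto simp: M_def)
  qed
  ultimately show ?thesis using CR by (intro finite_residues_if_bounded_degree[of C N]) auto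
qed

lemma finite_residue_field:
  fixes k R P :: "'f::field set"
  assumes ff: "function_field ring_of_type_algebra k t" and fin: "finite k"
    and prime: "prime_of ring_of_type_algebra k R P"
  shows "finite (subring_prime_ideal.residue P ` R)"
proof -
  interpret F: field "ring_of_type_algebra :: 'f ring" ..
  have k: "subfield k (ring_of_type_algebra :: 'f ring)" and
    fd: "ring.finite_dimension ring_of_type_algebra (generate_field ring_of_type_algebra (insert t k)) (UNIV :: 'f set)"
    using ff by (simp_all add: function_field_def)
  have k1: "subring k ring_of_type_algebra" by (rule subfieldE(1)[OF k])
  note kc = subring_of_type[OF k1]
  have k2: "inverse c \<in> k" if "c \<in> k" for c
    using F.subfield_m_inv(1)[OF k, of c] that by (cases "c = 0") auto
  have gf: "subfield (generate_field ring_of_type_algebra (insert t k)) (ring_of_type_algebra :: 'f ring)"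
    by (rule F.generate_field_is_subfield) simp
  \<comment> \<open>one of \<open>t\<close> and \<open>1 / t\<close> is integral, and both generate the same field over \<open>k\<close>\<close>
  define s where "s = (if t \<in> R then t else inverse t)"
  have "s \<in> R"
  proof (cases "t \<in> R")
    case False
    let ?v = "valuation ring_of_type_algebra R P"
    interpret v: valued_field ?v by (rule prime_valuation(1)[OF prime])
    note R = prime_valuation(2)[OF prime]
    have "t \<noteq> 0" using False subring_of_type(1)[of R] prime by (auto simp: prime_of_def)
    then have "?v t + ?v (inverse t) = 0" using v.mult[of t "inverse t"] by simp
    with False show ?thesis using R[of t] R[of "inverse t"] by (auto simp: s_def)
  qed (simp add: s_def)
  define C where "C = (\<lambda>r. poly r s) ` polys_over k"
  have pk: "subring (polys_over k) ring_of_type_algebra" by (rule subring_polys_over[OF k1])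
  note pc = subring_of_type[OF pk]
  have C: "subring C ring_of_type_algebra"
    unfolding C_def by (rule subring_poly_values) fact
  have kC: "c \<in> C" if "c \<in> k" for c
    using that polys_over_pCons[OF k1, of c 0] polys_over_0[OF k1]
    by (auto simp: C_def intro!: image_eqI[of _ _ "[:c:]"])
  have sC: "s \<in> C"
    using polys_over_pCons[OF k1] polys_over_0[OF k1] kc
    by (auto simp: C_def intro!: image_eqI[of _ _ "[:0, 1:]"])
  have "insert t k \<subseteq> fractions C"
  proof
    fix x assume "x \<in> insert t k"
    then consider "x \<in> k" | "x = t" "t \<in> R" | "x = t" "t \<notin> R" by blast
    then show "x \<in> fractions C"
    proof cases
      case 1
      then show ?thesis unfolding fractions_def using kC[of x] kC[of 1] kc
        by (intro CollectI exI[of _ x] exI[of _ 1]) auto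
    next
      case 2
      then show ?thesis unfolding fractions_def using sC kC[of 1] kc
        by (intro CollectI exI[of _ s] exI[of _ 1]) (auto simp: s_def)
    next
      case 3
      then have "t \<noteq> 0" using subring_of_type(1)[of R] prime by (auto simp: prime_of_def)
      with 3 show ?thesis unfolding fractions_def using sC kC[of 1] kc
        by (intro CollectI exI[of _ 1] exI[of _ s]) (auto simp: s_def field_simps)
    qed
  qed
  then have sub: "generate_field ring_of_type_algebra (insert t k) \<subseteq> fractions C"
    by (rule generate_field_subset_fractions[OF C])
  obtain N where N: "\<And>a. \<exists>g \<in> polys_over (generate_field ring_of_type_algebra (insert t k)).
      g \<noteq> 0 \<and> degree g \<le> N \<and> poly g a = 0"
    using that by (rule bounded_algebraic_relation[OF gf fd])
  have "\<exists>g \<in> polys_over C. g \<noteq> 0 \<and> degree g \<le> N \<and> poly g a = 0" for a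
  proof -
    obtain g where g: "g \<in> polys_over (fractions C)" "g \<noteq> 0" "degree g \<le> N" "poly g a = 0"
      using N[of a] subsetD[OF sub] by (auto simp: polys_over_def)
    with clear_denominators[OF C g(1)] obtain d where "d \<noteq> 0" "smult d g \<in> polys_over C" by blast
    with g show ?thesis by (intro bexI[of _ "smult d g"]) auto
  qed
  then show ?thesis
    using finite_residues_over_polynomial_subring[OF prime k1 k2 fin \<open>s \<in> R\<close> C_def] by blast
qed

section \<open>The Frobenius argument\<close>

context subring_prime_ideal
begin

definition cong :: "'a \<Rightarrow> 'a \<Rightarrow> bool" (infix \<open>\<approx>\<close> 50) where "x \<approx> y \<longleftrightarrow> x - y \<in> I"

lemma cong_refl [simp]: "x \<approx> x" by (simp add: cong_def I_0)

lemma cong_sym: "x \<approx> y \<Longrightarrow> y \<approx> x" using I_swap by (simp add: cong_def)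

lemma cong_trans [trans]: "x \<approx> y \<Longrightarrow> y \<approx> z \<Longrightarrow> x \<approx> z"
  using I_trans by (simp add: cong_def)

lemma cong_add: "x \<approx> y \<Longrightarrow> x' \<approx> y' \<Longrightarrow> x + x' \<approx> y + y'"
  using I_add[of "x - y" "x' - y'"] by (simp add: cong_def algebra_simps)

lemma cong_minus: "x \<approx> y \<Longrightarrow> - x \<approx> - y"
  using I_minus[of "x - y"] by (simp add: cong_def)

lemma cong_diff: "x \<approx> y \<Longrightarrow> x' \<approx> y' \<Longrightarrow> x - x' \<approx> y - y'"
  using cong_add[of x y "- x'" "- y'"] cong_minus[of x' y'] by simp

lemma cong_mult:
  assumes "x \<approx> y" "x' \<approx> y'" "x \<in> S" "y' \<in> S"
  shows "x * x' \<approx> y * y'"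
proof -
  have "x * x' - y * y' = x * (x' - y') + y' * (x - y)" by (simp add: algebra_simps)
  also have "\<dots> \<in> I" using assms by (intro I_add I_mult) (auto simp: cong_def)
  finally show ?thesis by (simp add: cong_def)
qed

lemma cong_power: "x \<approx> y \<Longrightarrow> x \<in> S \<Longrightarrow> y \<in> S \<Longrightarrow> x ^ k \<approx> y ^ k"
  by (induction k) (auto intro!: cong_mult closed)

lemma cong_prod:
  assumes "\<And>i. i \<in> A \<Longrightarrow> f i \<approx> g i" "\<And>i. i \<in> A \<Longrightarrow> f i \<in> S" "\<And>i. i \<in> A \<Longrightarrow> g i \<in> S"
  shows "prod f A \<approx> prod g A"
  using assms
proof (induction A rule: infinite_finite_induct)
  case (insert i A)
  then show ?case by (simp add: cong_mult subring_prod[OF S])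
qed auto

lemma cong_squares:
  assumes "x\<^sup>2 \<approx> y\<^sup>2" "x \<in> S" "y \<in> S"
  shows "x \<approx> y \<or> x \<approx> - y"
proof -
  have "(x - y) * (x - - y) \<in> I"
    using assms(1) by (simp add: cong_def power2_eq_square algebra_simps)
  with I_prime[of "x - y" "x - - y"] assms(2,3) closed show ?thesis by (auto simp: cong_def)
qed

end

text \<open>
  The abstract form of the argument over a finite residue field with \<open>Q\<close> elements.  Here
  \<open>\<phi>(x) = x\<^sup>Q\<close> is the Frobenius map, \<open>\<theta> = u 0\<close> is a root of the polynomial that is supposed to
  be irreducible, and \<open>u i\<close> is the image of \<open>\<theta>\<close> under the \<open>i\<close>-th iterate, of degree \<open>2\<^bsup>n-i\<^esup>\<close>
  over the residue field.
\<close>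
locale frobenius_tower = subring_prime_ideal S I for S I :: "'a::comm_ring_1 set" +
  fixes Q n :: nat and m \<gamma> :: 'a and u a :: "nat \<Rightarrow> 'a"
  assumes Q_odd: "odd Q"
    and frob_add: "\<And>x y :: 'a. (x + y) ^ Q = x ^ Q + y ^ Q"
    and two: "2 \<notin> I" and m: "m \<in> S" "m ^ Q \<approx> m" and \<gamma>: "\<gamma> \<in> S" "\<gamma> ^ Q \<approx> \<gamma>"
    and u: "u 0 \<in> S" "\<And>i. u (Suc i) = (u i)\<^sup>2 + m" and u_n: "u n + \<gamma> \<in> I"
    and a: "a 0 = 0" "\<And>i. a (Suc i) = (a i)\<^sup>2 + m" and n: "n \<ge> 2"
begin

lemma Q_power_odd: "odd (Q ^ l)" using Q_odd by simp

lemma frob_Suc: "(x :: 'a) ^ (Q ^ Suc l) = (x ^ (Q ^ l)) ^ Q"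
  by (metis power_Suc2 power_mult)

lemma frob_frob: "(x :: 'a) ^ (Q ^ (l + h)) = (x ^ (Q ^ h)) ^ (Q ^ l)"
  by (metis add.commute power_add power_mult)

lemma frob_square: "((x :: 'a) ^ (Q ^ l))\<^sup>2 = (x\<^sup>2) ^ (Q ^ l)"
  by (metis mult.commute power_mult)

lemma frob_power_add: "(x + y :: 'a) ^ (Q ^ l) = x ^ (Q ^ l) + y ^ (Q ^ l)"
proof (induction l)
  case (Suc l)
  have "(x + y) ^ (Q ^ Suc l) = ((x + y) ^ (Q ^ l)) ^ Q" by (rule frob_Suc)
  also have "\<dots> = (x ^ (Q ^ l)) ^ Q + (y ^ (Q ^ l)) ^ Q" by (simp add: Suc frob_add)
  finally show ?case by (simp only: frob_Suc)
qed simp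

lemma frob_power_minus: "(- x :: 'a) ^ (Q ^ l) = - (x ^ (Q ^ l))"
  using Q_power_odd by (rule power_minus_odd)

lemma frob_power_diff: "(x - y :: 'a) ^ (Q ^ l) = x ^ (Q ^ l) - y ^ (Q ^ l)"
  using frob_power_add[of x "- y" l] by (simp add: frob_power_minus)

lemma frob_power_fixed: "c \<in> S \<Longrightarrow> c ^ Q \<approx> c \<Longrightarrow> c ^ (Q ^ l) \<approx> c"
proof (induction l)
  case (Suc l)
  have "c ^ (Q ^ Suc l) = (c ^ (Q ^ l)) ^ Q" by (rule frob_Suc)
  also have "\<dots> \<approx> c ^ Q" using Suc closed by (intro cong_power) auto
  also note \<open>c ^ Q \<approx> c\<close>
  finally show ?case .
qed simp

lemma u_S: "u i \<in> S"
  by (induction i) (auto simp: u m intro!: closed)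

lemma a_S: "a i \<in> S"
  by (induction i) (auto simp: a m intro!: closed)

lemma frob_square_root:
  assumes q: "u (Suc i) ^ (Q ^ l) \<approx> u (Suc i)"
  shows "u i ^ (Q ^ l) \<approx> u i \<or> u i ^ (Q ^ l) \<approx> - u i"
proof -
  have "(u i ^ (Q ^ l))\<^sup>2 = (u (Suc i) - m) ^ (Q ^ l)"
    by (simp add: u frob_square)
  also have "\<dots> = u (Suc i) ^ (Q ^ l) - m ^ (Q ^ l)" by (rule frob_power_diff)
  also have "\<dots> \<approx> u (Suc i) - m" by (rule cong_diff[OF q frob_power_fixed[OF m]])
  also have "u (Suc i) - m = (u i)\<^sup>2" by (simp add: u)
  finally show ?thesis using u_S closed by (intro cong_squares) auto
qed

lemma frob_twice:
  assumes "u i ^ (Q ^ l) \<approx> u i \<or> u i ^ (Q ^ l) \<approx> - u i"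
  shows "u i ^ (Q ^ (2 * l)) \<approx> u i"
proof -
  have *: "u i ^ (Q ^ (2 * l)) = (u i ^ (Q ^ l)) ^ (Q ^ l)"
    by (simp only: mult_2 frob_frob)
  show ?thesis using assms
  proof
    assume A: "u i ^ (Q ^ l) \<approx> u i"
    have "(u i ^ (Q ^ l)) ^ (Q ^ l) \<approx> u i ^ (Q ^ l)" using A u_S closed by (intro cong_power) auto
    also note A
    finally show ?thesis by (simp only: *)
  next
    assume A: "u i ^ (Q ^ l) \<approx> - u i"
    have "(u i ^ (Q ^ l)) ^ (Q ^ l) \<approx> (- u i) ^ (Q ^ l)" using A u_S closed by (intro cong_power) auto
    also have "(- u i) ^ (Q ^ l) = - (u i ^ (Q ^ l))" by (rule frob_power_minus)
    also have "\<dots> \<approx> - (- u i)" using A by (rule cong_minus)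
    finally show ?thesis by (simp add: *)
  qed
qed

text \<open>
  For \<open>i = n - j\<close> this says that \<open>u i\<close> lies in the field with
  \<open>Q\<^bsup>2^j\<^esup>\<close> elements: the value \<open>u n\<close> lies in the residue
  field, and each further \<open>u i\<close> is a square root over the field before.
\<close>
lemma frob_u: "j \<le> n \<Longrightarrow> u (n - j) ^ (Q ^ 2 ^ j) \<approx> u (n - j)"
proof (induction j)
  case 0
  have un: "u n \<approx> - \<gamma>" using u_n by (simp add: cong_def)
  have "u n ^ Q \<approx> (- \<gamma>) ^ Q" using un u_S closed \<gamma> by (intro cong_power) auto
  also have "(- \<gamma>) ^ Q = - (\<gamma> ^ Q)" using frob_power_minus[of \<gamma> 1] by simp
  also have "\<dots> \<approx> - \<gamma>" using \<gamma>(2) by (rule cong_minus)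
  also have "\<dots> \<approx> u n" using un by (rule cong_sym)
  finally show ?case by simp
next
  case (Suc j)
  then have "Suc (n - Suc j) = n - j" by simp
  with Suc have "u (Suc (n - Suc j)) ^ (Q ^ 2 ^ j) \<approx> u (Suc (n - Suc j))" by simp
  from frob_twice[OF frob_square_root[OF this]] show ?case by simp
qed

text \<open>
  If one of the square roots is rational over the field before, then all later ones lie in fields
  half as large in degree as expected, up to \<open>u 0\<close>.
\<close>
lemma frob_u_if_fixed:
  assumes "u i ^ (Q ^ 2 ^ (n - Suc i)) \<approx> u i" "i < n"
  shows "u 0 ^ (Q ^ 2 ^ (n - 1)) \<approx> u 0"
  using assms
proof (induction i)
  case (Suc i)
  have "n - Suc i = Suc (n - Suc (Suc i))" using Suc.prems by simp
  with frob_twice[OF frob_square_root[OF Suc.prems(1)]]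
  have "u i ^ (Q ^ 2 ^ (n - Suc i)) \<approx> u i" by simp
  with Suc show ?case by simp
qed simp

end

text \<open>
  The extra condition says that \<open>\<theta>\<close> does not lie in the subfield of index 2.
  It holds when \<open>\<theta>\<close> generates a field of degree
  \<open>2\<^bsup>n\<^esup>\<close>, and it forces every step of the tower to be a proper
  quadratic extension.
\<close>
locale frobenius_tower_of_full_degree = frobenius_tower S I Q n m \<gamma> u a
  for S I :: "'a::comm_ring_1 set" and Q n m \<gamma> u a +
  assumes not_fixed: "\<not> u 0 ^ (Q ^ 2 ^ (n - 1)) \<approx> u 0"
begin

lemma frob_conjugate:
  assumes "i < n"
  shows "u i ^ (Q ^ 2 ^ (n - Suc i)) \<approx> - u i"
proof -
  have "Suc i = n - (n - Suc i)" using assms by simp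
  then have "u (Suc i) ^ (Q ^ 2 ^ (n - Suc i)) \<approx> u (Suc i)" using frob_u[of "n - Suc i"] by simp
  from frob_square_root[OF this] frob_u_if_fixed[OF _ assms] not_fixed show ?thesis by blast
qed

text \<open>Multiplying together the factors of \<open>l\<close> and \<open>l + 2\<^bsup>n-i-1\<^esup>\<close>, which are conjugate over the
  field of \<open>u (i + 1)\<close>, halves the number of factors and advances \<open>i\<close> and the critical orbit.\<close>
lemma norm_step:
  assumes "i < n"
  shows "(\<Prod>l<2 ^ (n - i). a i - u i ^ (Q ^ l)) \<approx> (\<Prod>l<2 ^ (n - Suc i). a (Suc i) - u (Suc i) ^ (Q ^ l))"
proof -
  define h where "h = (2::nat) ^ (n - Suc i)"
  have "n - i = Suc (n - Suc i)" using assms by simp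
  then have 2: "2 ^ (n - i) = h + h" by (simp add: h_def mult_2)
  have split: "(\<Prod>l<h + h. f l) = (\<Prod>l<h. f l * f (l + h))" for f :: "nat \<Rightarrow> 'a"
  proof -
    have "(\<Prod>l<h + h. f l) = (\<Prod>l<h. f l) * (\<Prod>l\<in>{h..<h + h}. f l)"
      by (subst prod.union_disjoint[symmetric]) (auto intro: prod.cong)
    also have "(\<Prod>l\<in>{h..<h + h}. f l) = (\<Prod>l<h. f (l + h))"
      by (rule prod.reindex_bij_witness[of _ "\<lambda>l. l + h" "\<lambda>l. l - h"]) auto
    finally show ?thesis by (simp add: prod.distrib)
  qed
  show ?thesis
    unfolding 2 h_def[symmetric] split
  proof (rule cong_prod)
    fix l
    let ?b = "u i ^ (Q ^ l)"
    have "u i ^ (Q ^ (l + h)) = (u i ^ (Q ^ h)) ^ (Q ^ l)" by (rule frob_frob)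
    also have "\<dots> \<approx> (- u i) ^ (Q ^ l)"
      using frob_conjugate[OF assms] u_S closed unfolding h_def by (intro cong_power) auto
    also have "(- u i) ^ (Q ^ l) = - ?b" by (rule frob_power_minus)
    finally have "a i - u i ^ (Q ^ (l + h)) \<approx> a i - - ?b" by (intro cong_diff) auto
    then have "(a i - ?b) * (a i - u i ^ (Q ^ (l + h))) \<approx> (a i - ?b) * (a i - - ?b)"
      using a_S u_S closed by (intro cong_mult) auto
    also have "(a i - ?b) * (a i - - ?b) = (a i)\<^sup>2 - ?b\<^sup>2" by (simp add: power2_eq_square algebra_simps)
    also have "?b\<^sup>2 = (u (Suc i) - m) ^ (Q ^ l)"
      by (simp add: u frob_square)
    also have "\<dots> = u (Suc i) ^ (Q ^ l) - m ^ (Q ^ l)" by (rule frob_power_diff)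
    also have "(a i)\<^sup>2 - \<dots> \<approx> (a i)\<^sup>2 - (u (Suc i) ^ (Q ^ l) - m)"
      by (intro cong_diff cong_refl frob_power_fixed[OF m])
    also have "\<dots> = a (Suc i) - u (Suc i) ^ (Q ^ l)" by (simp add: a)
    finally show "(a i - ?b) * (a i - u i ^ (Q ^ (l + h))) \<approx> a (Suc i) - u (Suc i) ^ (Q ^ l)" .
  qed (use a_S u_S closed in auto)
qed

text \<open>
  Descending the tower from \<open>\<theta>\<close> to the residue field evaluates the norm of
  \<open>-\<theta>\<close>, a product of \<open>2\<^bsup>n\<^esup>\<close> conjugates.
\<close>
lemma norm_eq_final_critical_value: "(\<Prod>l<2 ^ n. - (u 0 ^ (Q ^ l))) \<approx> a n + \<gamma>"
proof -
  have "(\<Prod>l<2 ^ n. a 0 - u 0 ^ (Q ^ l)) \<approx> (\<Prod>l<2 ^ (n - i). a i - u i ^ (Q ^ l))" if "i \<le> n" for i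
    using that
  proof (induction i)
    case (Suc i)
    then have "i \<le> n" "i < n" by simp_all
    from cong_trans[OF Suc.IH[OF this(1)] norm_step[OF this(2)]] show ?case .
  qed simp
  from this[of n] have "(\<Prod>l<2 ^ n. - (u 0 ^ (Q ^ l))) \<approx> a n - u n" by (simp add: a)
  also have "\<dots> \<approx> a n + \<gamma>" using I_minus[OF u_n] by (simp add: cong_def)
  finally show ?thesis .
qed

text \<open>
  Let \<open>N\<close> be the product of the first half of the conjugates of
  \<open>\<theta>\<close>. The second half consists of their negatives, so
  \<open>N\<^sup>2\<close> is the norm. If that is the square of an element fixed by Frobenius,
  then \<open>N\<close> is fixed by Frobenius as well. But Frobenius drops the factor
  \<open>\<theta>\<close> from \<open>N\<close> and adds \<open>-\<theta>\<close>, so it changes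
  the sign of \<open>N\<close>. This is a contradiction because neither \<open>2\<close> nor
  \<open>N\<close> vanishes.
\<close>
lemma final_critical_value_nonsquare:
  assumes c: "c \<in> S" "c ^ Q \<approx> c"
  shows "\<not> a n + \<gamma> \<approx> c\<^sup>2"
proof
  assume sq: "a n + \<gamma> \<approx> c\<^sup>2"
  define D where "D = (2::nat) ^ (n - 1)"
  have "n = Suc (n - 1)" using n by simp
  then have D: "2 ^ n = D + D" by (metis D_def mult_2 power_Suc)
  have "n - 1 = Suc (n - 2)" using n by simp
  then have "even D" by (simp add: D_def)
  let ?\<theta> = "u 0"
  define N where "N = (\<Prod>l<D. ?\<theta> ^ (Q ^ l))"
  have N_S: "N \<in> S" unfolding N_def using u_S closed by (intro subring_prod[OF S]) auto
  have conj: "?\<theta> ^ (Q ^ D) \<approx> - ?\<theta>" using frob_conjugate[of 0] n by (simp add: D_def)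
  have "even ((2::nat) ^ n)" using n by simp
  have split: "(\<Prod>l<D + D. ?\<theta> ^ (Q ^ l)) = N * (\<Prod>l<D. ?\<theta> ^ (Q ^ (l + D)))"
  proof -
    have "(\<Prod>l<D + D. ?\<theta> ^ (Q ^ l)) = N * (\<Prod>l\<in>{D..<D + D}. ?\<theta> ^ (Q ^ l))"
      unfolding N_def by (subst prod.union_disjoint[symmetric]) (auto intro: prod.cong)
    also have "(\<Prod>l\<in>{D..<D + D}. ?\<theta> ^ (Q ^ l)) = (\<Prod>l<D. ?\<theta> ^ (Q ^ (l + D)))"
      by (rule prod.reindex_bij_witness[of _ "\<lambda>l. l + D" "\<lambda>l. l - D"]) auto
    finally show ?thesis .
  qed
  have "(\<Prod>l<D. ?\<theta> ^ (Q ^ (l + D))) \<approx> (\<Prod>l<D. - (?\<theta> ^ (Q ^ l)))"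
  proof (rule cong_prod)
    fix l
    have "?\<theta> ^ (Q ^ (l + D)) = (?\<theta> ^ (Q ^ D)) ^ (Q ^ l)" by (rule frob_frob)
    also have "\<dots> \<approx> (- ?\<theta>) ^ (Q ^ l)" using conj u_S closed by (intro cong_power) auto
    also have "(- ?\<theta>) ^ (Q ^ l) = - (?\<theta> ^ (Q ^ l))" by (rule frob_power_minus)
    finally show "?\<theta> ^ (Q ^ (l + D)) \<approx> - (?\<theta> ^ (Q ^ l))" .
  qed (use u_S closed in auto)
  also have "(\<Prod>l<D. - (?\<theta> ^ (Q ^ l))) = N"
    using \<open>even D\<close> by (simp add: N_def prod_uminus)
  finally have "N * (\<Prod>l<D. ?\<theta> ^ (Q ^ (l + D))) \<approx> N * N"
    using N_S by (intro cong_mult) auto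
  also have "N * (\<Prod>l<D. ?\<theta> ^ (Q ^ (l + D))) = (\<Prod>l<2 ^ n. - (?\<theta> ^ (Q ^ l)))"
    using \<open>even (2 ^ n)\<close> by (simp add: prod_uminus D split)
  finally have "N * N \<approx> (\<Prod>l<2 ^ n. - (?\<theta> ^ (Q ^ l)))" by (rule cong_sym)
  also note norm_eq_final_critical_value
  also note sq
  finally have "N\<^sup>2 \<approx> c\<^sup>2" by (simp only: power2_eq_square)
  then have N_c: "N \<approx> c \<or> N \<approx> - c" using N_S c by (intro cong_squares) auto
  \<comment> \<open>as \<open>c\<close> is fixed by Frobenius, so is \<open>N\<close>\<close>
  have "N ^ Q \<approx> N"
  proof -
    have "e ^ Q \<approx> e" if "e = c \<or> e = - c" for e
      using that c(2) cong_minus[OF c(2)] power_minus_odd[OF Q_odd, of c] by auto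
    moreover obtain e where e: "e = c \<or> e = - c" "N \<approx> e" using N_c by blast
    moreover have "N ^ Q \<approx> e ^ Q" using e N_S c closed by (intro cong_power) auto
    ultimately have "N ^ Q \<approx> e" "e \<approx> N" using cong_trans[of "N ^ Q" "e ^ Q" e] cong_sym[of N e] by blast+
    then show ?thesis by (rule cong_trans)
  qed
  have shift: "?\<theta> * N ^ Q = N * ?\<theta> ^ (Q ^ D)"
  proof -
    have "N ^ Q = (\<Prod>l<D. ?\<theta> ^ (Q ^ Suc l))" unfolding N_def frob_Suc by (rule prod_power_distrib)
    then have "?\<theta> * N ^ Q = (\<Prod>l<Suc D. ?\<theta> ^ (Q ^ l))" by (subst prod.lessThan_Suc_shift) simp
    then show ?thesis by (simp add: N_def)
  qed
  have "?\<theta> * N \<approx> ?\<theta> * N ^ Q" using \<open>N ^ Q \<approx> N\<close> N_S u_S closed by (intro cong_mult cong_sym[of "N ^ Q"]) auto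
  also have "\<dots> \<approx> N * - ?\<theta>" unfolding shift using conj N_S u_S closed by (intro cong_mult) auto
  finally have "2 * (?\<theta> * N) \<in> I" by (simp add: cong_def algebra_simps)
  moreover have "2 \<in> S" using closed(4)[OF closed(2) closed(2)] by simp
  ultimately have \<theta>_or_N: "?\<theta> \<in> I \<or> N \<in> I"
    using I_prime[OF _ closed(5)[OF u_S N_S]] I_prime[OF u_S N_S] two by blast
  have power: "x \<in> I" if "x ^ k \<in> I" "x \<in> S" for x k
    using that
  proof (induction k)
    case (Suc k)
    then show ?case using I_prime[of x "x ^ k"] closed by auto
  qed (use I_proper in auto)
  have prod: "\<exists>i \<in> A. f i \<in> I" if "prod f A \<in> I" "finite A" "\<And>i. f i \<in> S" for f :: "nat \<Rightarrow> 'a" and A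
    using that(2,1)
  proof (induction A rule: finite_induct)
    case (insert i A)
    then show ?case using I_prime[of "f i" "prod f A"] subring_prod[OF S, of A f] that(3) by auto
  qed (use I_proper in auto)
  have "?\<theta> \<in> I"
  proof (cases "N \<in> I")
    case True
    then obtain l where "?\<theta> ^ (Q ^ l) \<in> I"
      unfolding N_def using prod[of "\<lambda>l. ?\<theta> ^ (Q ^ l)" "{..<D}"] u_S closed by auto
    then show ?thesis using power u_S by blast
  qed (use \<theta>_or_N in blast)
  then have "?\<theta> ^ (Q ^ D) \<approx> ?\<theta>"
  proof -
    assume \<theta>: "?\<theta> \<in> I"
    have "Q ^ D = Suc (Q ^ D - 1)" using odd_pos[OF Q_power_odd[of D]] by simp
    then have "?\<theta> ^ (Q ^ D) = ?\<theta> ^ (Q ^ D - 1) * ?\<theta>" by (metis power_Suc2)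
    then have "?\<theta> ^ (Q ^ D) \<in> I" using I_mult \<theta> u_S closed by simp
    then show ?thesis using \<theta> I_diff by (simp add: cong_def)
  qed
  with not_fixed show False by (simp add: D_def)
qed

end

section \<open>Polynomials over the residue field\<close>

locale residue_field_of_prime =
  fixes k R P :: "'f::field set"
  assumes prime: "prime_of ring_of_type_algebra k R P"
begin

sublocale subring_prime_ideal R P
  by (rule subring_prime_ideal_prime_of[OF prime])

abbreviation K :: "'f set ring" where "K \<equiv> residue_ring_at ring_of_type_algebra R P"

lemma coset_eq_residue: "P +>\<^bsub>ring_of_type_algebra\<lparr>carrier := R\<rparr>\<^esub> x = residue x"
  by (auto simp: a_r_coset_def' residue_def image_iff intro: bexI[of _ "_ - x"])

lemma field_K: "field K"
  and residue_hom: "residue \<in> ring_hom ((ring_of_type_algebra :: 'f ring)\<lparr>carrier := R\<rparr>) K"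
proof -
  have "principal_domain ((ring_of_type_algebra :: 'f ring)\<lparr>carrier := R\<rparr>)"
    and M: "maximalideal P ((ring_of_type_algebra :: 'f ring)\<lparr>carrier := R\<rparr>)"
    using prime by (simp_all add: prime_of_def discrete_valuation_ring_def)
  then interpret A: principal_domain "(ring_of_type_algebra :: 'f ring)\<lparr>carrier := R\<rparr>" by simp
  interpret M: maximalideal P "(ring_of_type_algebra :: 'f ring)\<lparr>carrier := R\<rparr>" by (rule M)
  show "field K" unfolding residue_ring_at_def by (rule M.quotient_is_field) (rule A.is_cring)
  have "residue = (+>\<^bsub>ring_of_type_algebra\<lparr>carrier := R\<rparr>\<^esub>) P" by (rule ext) (simp add: coset_eq_residue)
  then show "residue \<in> ring_hom ((ring_of_type_algebra :: 'f ring)\<lparr>carrier := R\<rparr>) K"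
    unfolding residue_ring_at_def using M.rcos_ring_hom by simp
qed

sublocale K: field K by (rule field_K)

lemma carrier_K: "carrier K = residue ` R"
  by (auto simp: residue_ring_at_def FactRing_def A_RCOSETS_def' coset_eq_residue)

lemma residue_in_K [simp]: "x \<in> R \<Longrightarrow> residue x \<in> carrier K"
  by (simp add: carrier_K)

lemma zero_K: "\<zero>\<^bsub>K\<^esub> = residue 0"
  by (auto simp: residue_ring_at_def FactRing_def residue_def)

lemma residue_one: "residue 1 = \<one>\<^bsub>K\<^esub>"
  using ring_hom_one[OF residue_hom] by simp

lemma residue_add: "x \<in> R \<Longrightarrow> y \<in> R \<Longrightarrow> residue (x + y) = residue x \<oplus>\<^bsub>K\<^esub> residue y"
  using ring_hom_add[OF residue_hom] by simp

lemma residue_mult: "x \<in> R \<Longrightarrow> y \<in> R \<Longrightarrow> residue (x * y) = residue x \<otimes>\<^bsub>K\<^esub> residue y"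
  using ring_hom_mult[OF residue_hom] by simp

lemma residue_power: "x \<in> R \<Longrightarrow> residue (x ^ n) = residue x [^]\<^bsub>K\<^esub> n"
  by (induction n) (simp_all add: residue_one residue_mult closed K.m_comm)

lemma residue_sum:
  fixes f :: "nat \<Rightarrow> 'f"
  assumes "\<And>i. f i \<in> R"
  shows "residue (\<Sum>i\<le>n. f i) = (\<Oplus>\<^bsub>K\<^esub>i\<in>{..n}. residue (f i))"
proof (induction n)
  case 0
  show ?case using assms by simp
next
  case (Suc n)
  have "(\<Sum>i\<le>n. f i) \<in> R" using assms by (intro subring_sum[OF S])
  then have "residue (\<Sum>i\<le>Suc n. f i) = residue (f (Suc n)) \<oplus>\<^bsub>K\<^esub> residue (\<Sum>i\<le>n. f i)"
    using assms by (simp add: residue_add K.a_comm)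
  also have "\<dots> = (\<Oplus>\<^bsub>K\<^esub>i\<in>{..Suc n}. residue (f i))"
    using assms by (subst K.finsum_Suc) (auto simp: Suc)
  finally show ?case .
qed

text \<open>
  Reduction is a surjective ring homomorphism from \<open>R[x]\<close> to the polynomial ring over
  the residue field, with kernel \<open>P[x]\<close>; coefficientwise descriptions avoid the list
  representation of polynomials.
\<close>
lemma reduce_poly_eq: "reduce_poly R P g = K.normalize (map residue (rev (coeffs g)))"
  by (simp add: reduce_poly_def coset_eq_residue)

lemma set_map_residue:
  assumes "g \<in> polys_over R"
  shows "set (map residue (rev (coeffs g))) \<subseteq> carrier K"
  using assms by (auto simp: polys_over_def coeffs_def split: if_splits)

lemma reduce_in_carrier: "g \<in> polys_over R \<Longrightarrow> reduce_poly R P g \<in> carrier (poly_ring K)"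
  unfolding reduce_poly_eq univ_poly_carrier[symmetric]
  by (intro K.normalize_gives_polynomial set_map_residue)

lemma coeff_map_residue: "K.coeff (map residue (rev (coeffs g))) i = residue (coeff g i)"
proof (cases "i < length (coeffs g)")
  case True
  then have "coeffs g ! i = coeff g i" by (metis nth_default_coeffs_eq nth_default_nth)
  with True show ?thesis by (simp add: K.coeff_nth rev_nth)
next
  case False
  then have "coeff g i = 0" by (metis nth_default_coeffs_eq nth_default_beyond linorder_not_less)
  with False show ?thesis by (simp add: K.coeff_length zero_K)
qed

lemma coeff_reduce: "K.coeff (reduce_poly R P g) i = residue (coeff g i)"
  using coeff_map_residue K.normalize_coeff by (simp add: reduce_poly_eq flip: K.normalize_coeff)

lemma poly_ring_eqI:
  assumes "p \<in> carrier (poly_ring K)" "q \<in> carrier (poly_ring K)" "\<And>i. K.coeff p i = K.coeff q i"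
  shows "p = q"
  using K.coeff_iff_polynomial_cond[of "carrier K" p q] assms by (auto simp: univ_poly_carrier)

lemma reduce_mult:
  assumes "g \<in> polys_over R" "h \<in> polys_over R"
  shows "reduce_poly R P (g * h) = reduce_poly R P g \<otimes>\<^bsub>poly_ring K\<^esub> reduce_poly R P h"
proof (rule poly_ring_eqI)
  interpret KX: ring "poly_ring K" by (rule K.univ_poly_is_ring[OF K.carrier_is_subring])
  show "reduce_poly R P (g * h) \<in> carrier (poly_ring K)"
    using subring_of_type(5)[OF subring_polys_over[OF S]] assms by (intro reduce_in_carrier) auto
  show "reduce_poly R P g \<otimes>\<^bsub>poly_ring K\<^esub> reduce_poly R P h \<in> carrier (poly_ring K)"
    using assms by (intro KX.m_closed reduce_in_carrier)
  have sets: "set (reduce_poly R P g) \<subseteq> carrier K" "set (reduce_poly R P h) \<subseteq> carrier K"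
    using assms reduce_in_carrier by (auto simp: univ_poly_carrier[symmetric] dest: K.polynomial_in_carrier[OF K.carrier_is_subring])
  have gh: "coeff g i \<in> R" "coeff h i \<in> R" for i using assms by (auto simp: polys_over_def)
  show "K.coeff (reduce_poly R P (g * h)) i = K.coeff (reduce_poly R P g \<otimes>\<^bsub>poly_ring K\<^esub> reduce_poly R P h) i" for i
    unfolding univ_poly_mult K.poly_mult_coeff[OF sets] coeff_reduce coeff_mult
    using gh closed by (subst residue_sum) (simp_all add: residue_mult)
qed

lemma reduce_surj:
  assumes "l \<in> carrier (poly_ring K)"
  obtains g where "g \<in> polys_over R" "reduce_poly R P g = l"
proof -
  have "set l \<subseteq> residue ` R"
    using assms K.polynomial_in_carrier[OF K.carrier_is_subring] carrier_K by (auto simp: univ_poly_carrier[symmetric])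
  define xs where "xs = map (inv_into R residue) l"
  have xs: "set xs \<subseteq> R" "l = map residue xs"
    using \<open>set l \<subseteq> residue ` R\<close>
    by (auto simp: xs_def f_inv_into_f subset_iff intro: inv_into_into intro!: map_idI[symmetric])
  define g where "g = Poly (rev xs)"
  have g: "g \<in> polys_over R"
    using xs(1) closed(1) nth_mem[of _ "rev xs"]
    by (auto simp: g_def polys_over_def coeff_Poly_eq nth_default_def simp del: nth_mem)
  have "reduce_poly R P g = l"
  proof (rule poly_ring_eqI[OF reduce_in_carrier[OF g] assms])
    show "K.coeff (reduce_poly R P g) i = K.coeff l i" for i
    proof (cases "i < length xs")
      case True
      then show ?thesis
        by (simp add: coeff_reduce g_def coeff_Poly_eq nth_default_def xs(2) K.coeff_nth rev_nth)
    next
      case False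
      then show ?thesis
        by (simp add: coeff_reduce g_def coeff_Poly_eq nth_default_def xs(2) K.coeff_length zero_K)
    qed
  qed
  with g that show thesis by blast
qed

lemma reduce_eq_iff:
  assumes "g \<in> polys_over R" "h \<in> polys_over R"
  shows "reduce_poly R P g = reduce_poly R P h \<longleftrightarrow> g - h \<in> polys_over P"
proof -
  have "reduce_poly R P g = reduce_poly R P h \<longleftrightarrow> (\<forall>i. residue (coeff g i) = residue (coeff h i))"
    using poly_ring_eqI[OF reduce_in_carrier[OF assms(1)] reduce_in_carrier[OF assms(2)]]
      coeff_reduce[of g] coeff_reduce[of h] by metis
  then show ?thesis by (simp add: residue_eq_iff polys_over_def)
qed

text \<open>
  The preimage in \<open>R[x]\<close> of the ideal generated by the reduction of \<open>p\<close>.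
\<close>
definition multiples_mod :: "'f poly \<Rightarrow> 'f poly set" where
  "multiples_mod p = {A \<in> polys_over R. \<exists>B \<in> polys_over R. A - p * B \<in> polys_over P}"

lemma multiples_mod_iff_divides:
  assumes p: "p \<in> polys_over R" and A: "A \<in> polys_over R"
  shows "A \<in> multiples_mod p \<longleftrightarrow> reduce_poly R P p pdivides\<^bsub>K\<^esub> reduce_poly R P A"
proof -
  note pc = subring_of_type[OF subring_polys_over[OF S]]
  have "A \<in> multiples_mod p \<longleftrightarrow> (\<exists>B \<in> polys_over R. reduce_poly R P A = reduce_poly R P p \<otimes>\<^bsub>poly_ring K\<^esub> reduce_poly R P B)"
    unfolding multiples_mod_def using A p pc by (auto simp flip: reduce_mult reduce_eq_iff)
  also have "\<dots> \<longleftrightarrow> reduce_poly R P p pdivides\<^bsub>K\<^esub> reduce_poly R P A"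
    unfolding pdivides_def factor_def using reduce_in_carrier reduce_surj by metis
  finally show ?thesis .
qed

text \<open>
  Irreducible polynomials over a field generate prime ideals. The reducibility of the reduction is
  proved by contradiction, and this is the only consequence of irreducibility that is drawn.
\<close>
lemma subring_prime_ideal_multiples_mod:
  assumes p: "p \<in> polys_over R" and irr: "ring_irreducible\<^bsub>poly_ring K\<^esub> (reduce_poly R P p)"
  shows "subring_prime_ideal (polys_over R) (multiples_mod p)"
proof -
  note pc = subring_of_type[OF subring_polys_over[OF S]]
  have pP: "g + h \<in> polys_over P" if "g \<in> polys_over P" "h \<in> polys_over P" for g h
    using that by (auto simp: polys_over_def I_add)
  have mP: "g * h \<in> polys_over P" if "g \<in> polys_over R" "h \<in> polys_over P" for g h
    using that by (auto simp: polys_over_def coeff_mult intro!: I_sum I_mult)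
  have pp: "ring_prime\<^bsub>poly_ring K\<^esub> (reduce_poly R P p)"
    using K.pprime_iff_pirreducible[OF K.carrier_is_subfield reduce_in_carrier[OF p]] irr by blast
  note prE = K.pprimeE[OF K.carrier_is_subfield reduce_in_carrier[OF p] pp]
  show ?thesis
  proof (unfold subring_prime_ideal_def, intro conjI allI impI)
    show "subring (polys_over R) ring_of_type_algebra" by (rule subring_polys_over[OF S])
    show "multiples_mod p \<subseteq> polys_over R" by (auto simp: multiples_mod_def)
    show "0 \<in> multiples_mod p"
    proof -
      have "0 \<in> polys_over P" by (simp add: polys_over_def I_0)
      with pc(1) show ?thesis by (auto simp: multiples_mod_def intro!: bexI[of _ 0])
    qed
    show "g + h \<in> multiples_mod p" if gh: "g \<in> multiples_mod p" "h \<in> multiples_mod p" for g h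
    proof -
      obtain B C where "B \<in> polys_over R" "C \<in> polys_over R" "g - p * B \<in> polys_over P" "h - p * C \<in> polys_over P"
        using gh by (auto simp: multiples_mod_def)
      moreover have "g + h - p * (B + C) = (g - p * B) + (h - p * C)" by (simp add: algebra_simps)
      ultimately have "B + C \<in> polys_over R" "g + h - p * (B + C) \<in> polys_over P" using pc(4) pP by metis+
      then show ?thesis using gh pc(4) unfolding multiples_mod_def by blast
    qed
    show "s * h \<in> multiples_mod p" if gh: "s \<in> polys_over R" "h \<in> multiples_mod p" for s h
    proof -
      obtain C where "C \<in> polys_over R" "h - p * C \<in> polys_over P"
        using gh by (auto simp: multiples_mod_def)
      moreover have "s * h - p * (s * C) = s * (h - p * C)" by (simp add: algebra_simps)
      ultimately have "s * C \<in> polys_over R" "s * h - p * (s * C) \<in> polys_over P" using gh(1) pc(5) mP by metis+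
      then show ?thesis using gh pc(5) unfolding multiples_mod_def by blast
    qed
    show "1 \<notin> multiples_mod p"
    proof
      assume "1 \<in> multiples_mod p"
      then have "reduce_poly R P p pdivides\<^bsub>K\<^esub> reduce_poly R P 1" using multiples_mod_iff_divides[OF p pc(2)] by blast
      moreover have "reduce_poly R P 1 = \<one>\<^bsub>poly_ring K\<^esub>"
      proof (rule poly_ring_eqI[OF reduce_in_carrier[OF pc(2)]])
        show one: "\<one>\<^bsub>poly_ring K\<^esub> \<in> carrier (poly_ring K)"
          by (simp add: ring.ring_simprules(6) K.univ_poly_is_ring[OF K.carrier_is_subring])
        show "K.coeff (reduce_poly R P 1) i = K.coeff \<one>\<^bsub>poly_ring K\<^esub> i" for i
          by (simp add: coeff_reduce univ_poly_one residue_one zero_K)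
      qed
      ultimately have "reduce_poly R P p divides\<^bsub>poly_ring K\<^esub> \<one>\<^bsub>poly_ring K\<^esub>" by (simp add: pdivides_def)
      moreover have "cring (poly_ring K)" by (rule K.univ_poly_is_cring[OF K.carrier_is_subring])
      ultimately have "reduce_poly R P p \<in> Units (poly_ring K)"
        using cring.divides_one reduce_in_carrier[OF p] by metis
      with prE(2) show False by blast
    qed
    show "g \<in> multiples_mod p \<or> h \<in> multiples_mod p"
      if "g \<in> polys_over R" "h \<in> polys_over R" "g * h \<in> multiples_mod p" for g h
      using that prE(3)[of "reduce_poly R P g" "reduce_poly R P h"] reduce_in_carrier reduce_mult pc(5)
        multiples_mod_iff_divides[OF p] by metis
  qed
qed

text \<open>The additive group of the residue field has exponent \<open>p\<close>, hence no subgroup of another prime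
  order.\<close>
lemma card_K_prime_power:
  assumes fin: "finite (residue ` R)" and char: "Factorial_Ring.prime CHAR('f)"
  obtains r where "card (residue ` R) = CHAR('f) ^ r"
proof -
  let ?p = "CHAR('f)"
  note grp = K.a_group
  have carr: "carrier (add_monoid K) = residue ` R" by (simp add: carrier_K)
  have pow: "residue x [^]\<^bsub>add_monoid K\<^esub> j = residue (of_nat j * x)" if "x \<in> R" for x and j :: nat
  proof (induction j)
    case 0
    then show ?case by (simp add: zero_K)
  next
    case (Suc j)
    have "(of_nat j :: 'f) \<in> R" by (induction j) (auto intro: closed)
    then show ?case using Suc that closed by (simp add: residue_add[symmetric] algebra_simps)
  qed
  have exp: "g [^]\<^bsub>add_monoid K\<^esub> ?p = \<one>\<^bsub>add_monoid K\<^esub>" if g: "g \<in> carrier (add_monoid K)" for g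
  proof -
    obtain x where "x \<in> R" "g = residue x" using g by (auto simp: carrier_K)
    with pow[of x ?p] show ?thesis by (simp add: zero_K)
  qed
  have ord: "Coset.order (add_monoid K) = card (residue ` R)" by (simp add: Coset.order_def carrier_K)
  have only: "q = ?p" if q: "Factorial_Ring.prime q" "q dvd card (residue ` R)" for q
  proof -
    obtain c where c: "card (residue ` R) = q ^ 1 * c" using q(2) by auto
    obtain H where H: "subgroup H (add_monoid K)" "card H = q ^ 1"
      using sylow_thm[OF q(1) grp, of 1 c] c ord fin carr by metis
    have "1 < card H" using H(2) prime_gt_1_nat[OF q(1)] by simp
    then have "\<not> H \<subseteq> {\<one>\<^bsub>add_monoid K\<^esub>}" using card_mono[of "{\<one>\<^bsub>add_monoid K\<^esub>}" H] by auto
    then obtain g where g: "g \<in> H" "g \<noteq> \<one>\<^bsub>add_monoid K\<^esub>" by blast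
    interpret H: group "(add_monoid K)\<lparr>carrier := H\<rparr>" by (rule subgroup.subgroup_is_group[OF H(1) grp])
    have gK: "g \<in> carrier (add_monoid K)" using g(1) subgroup.subset[OF H(1)] by blast
    have "g [^]\<^bsub>(add_monoid K)\<lparr>carrier := H\<rparr>\<^esub> card H = \<one>\<^bsub>(add_monoid K)\<lparr>carrier := H\<rparr>\<^esub>"
      using H.pow_order_eq_1[of g] g(1) by (simp add: Coset.order_def)
    then have "g [^]\<^bsub>add_monoid K\<^esub> card H = \<one>\<^bsub>add_monoid K\<^esub>"
      by (simp add: nat_pow_def)
    then have "group.ord (add_monoid K) g dvd q" "group.ord (add_monoid K) g dvd ?p" using group.pow_eq_id[OF grp gK] exp[OF gK] H(2) by auto
    moreover have "group.ord (add_monoid K) g \<noteq> 1" using group.ord_eq_1[OF grp gK] g(2) by auto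
    ultimately show ?thesis using q(1) char by (metis prime_nat_iff)
  qed
  have pos: "card (residue ` R) \<noteq> 0" using fin closed(1) by auto
  have "\<exists>e c. card (residue ` R) = ?p ^ e * c \<and> \<not> ?p dvd c"
    using multiplicity_decompose'[OF pos, of ?p] char not_prime_unit by metis
  then obtain e c where c: "card (residue ` R) = ?p ^ e * c" "\<not> ?p dvd c" by blast
  have "c = 1"
  proof (rule ccontr)
    assume "c \<noteq> 1"
    then obtain q where "Factorial_Ring.prime q" "q dvd c" using prime_factor_nat by blast
    with only[of q] c show False by (metis dvd_mult)
  qed
  with c(1) that show thesis by simp
qed

lemma power_card_K:
  assumes fin: "finite (residue ` R)" and x: "x \<in> R"
  shows "x ^ card (residue ` R) - x \<in> P"
proof -
  have "residue x [^]\<^bsub>K\<^esub> card (carrier K) = residue x"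
  proof (cases "residue x = \<zero>\<^bsub>K\<^esub>")
    case True
    have "card (carrier K) \<noteq> 0" using fin x by (auto simp: carrier_K)
    then show ?thesis using True by (simp add: K.nat_pow_zero)
  next
    case False
    interpret G: group "Multiplicative_Group.mult_of K" by (rule K.field_mult_group)
    have "residue x \<in> carrier (Multiplicative_Group.mult_of K)" using False x by simp
    from G.pow_order_eq_1[OF this]
    have "residue x [^]\<^bsub>K\<^esub> (card (carrier K) - 1) = \<one>\<^bsub>K\<^esub>"
      using fin by (simp add: Coset.order_def Multiplicative_Group.nat_pow_mult_of carrier_K zero_K closed)
    moreover have "card (carrier K) = Suc (card (carrier K) - 1)"
    proof -
      have "0 < card (carrier K)" using fin x by (auto simp: carrier_K card_gt_0_iff)
      then show ?thesis by simp
    qed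
    ultimately show ?thesis using x by (metis K.nat_pow_Suc K.l_one residue_in_K)
  qed
  then show ?thesis using x by (simp add: residue_power[symmetric] residue_eq_iff carrier_K)
qed

end

section \<open>Reducibility over the residue field\<close>

lemma of_nat_in_subring:
  assumes "subring S (ring_of_type_algebra :: 'a::comm_ring_1 ring)"
  shows "(of_nat j :: 'a) \<in> S"
  by (induction j) (auto intro: subring_of_type[OF assms])

lemma half_in_odd_char:
  assumes "odd CHAR('a::comm_ring_1)"
  shows "2 * of_nat (Suc CHAR('a) div 2) = (1 :: 'a)"
proof -
  have "2 * (Suc CHAR('a) div 2) = Suc CHAR('a)" using assms by simp
  then have "of_nat (2 * (Suc CHAR('a) div 2)) = (of_nat (Suc CHAR('a)) :: 'a)" by (simp only:)
  then show ?thesis by simp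
qed

context residue_field_of_prime
begin

text \<open>
  Modulo \<open>P\<close> a multiple of a monic polynomial of degree \<open>d\<close> that has
  degree less than \<open>d\<close> vanishes: the leading coefficient of the cofactor
  \<open>C\<close> lies in \<open>P\<close>, and its leading term can be removed.
\<close>
lemma polys_over_P_if_multiple:
  assumes p: "p \<in> polys_over R" "lead_coeff p = 1" and E: "degree E < degree p"
    and C: "C \<in> polys_over R" "E - p * C \<in> polys_over P"
  shows "E \<in> polys_over P"
  using C
proof (induction "degree C" arbitrary: C rule: less_induct)
  case less
  note pc = subring_of_type[OF subring_polys_over[OF S]]
  show ?case
  proof (cases "C = 0")
    case True
    with less.prems show ?thesis by simp
  next
    case False
    define c e where "c = lead_coeff C" and "e = degree C"
    have "coeff (E - p * C) (degree p + e) = - c"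
      using E p(2) by (simp add: coeff_eq_0 e_def c_def coeff_mult_degree_sum)
    moreover have "coeff (E - p * C) (degree p + e) \<in> P" using less.prems(2) by (simp add: polys_over_def)
    ultimately have c: "c \<in> P" by simp
    define C' where "C' = C - Polynomial.monom c e"
    have "degree C' \<le> e" unfolding C'_def e_def by (intro degree_diff_le) (auto simp: degree_monom_le)
    moreover have "coeff C' e = 0" by (simp add: C'_def c_def e_def)
    ultimately have C': "C' = 0 \<or> degree C' < degree C" unfolding e_def by (metis eq_zero_or_degree_less)
    have "Polynomial.monom c e \<in> polys_over P" using c I_0 by (auto simp: polys_over_def)
    then have pm: "p * Polynomial.monom c e \<in> polys_over P" "Polynomial.monom c e \<in> polys_over R"
      using p(1) I_subset c closed(1) by (auto simp: polys_over_def coeff_mult intro!: I_sum I_mult)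
    have "E - p * C' = (E - p * C) + p * Polynomial.monom c e" by (simp add: C'_def algebra_simps)
    also have "\<dots> \<in> polys_over P"
      using less.prems(2) pm(1) unfolding polys_over_def mem_Collect_eq coeff_add by (blast intro: I_add)
    finally have "E - p * C' \<in> polys_over P" .
    moreover have "C' \<in> polys_over R"
      unfolding C'_def using less.prems(1) pm(2) by (rule pc(6))
    ultimately show ?thesis using less.hyps[of C'] C' less.prems by auto
  qed
qed

lemma card_K_gt_1:
  assumes "finite (residue ` R)"
  shows "1 < card (residue ` R)"
proof -
  have "residue 0 \<noteq> residue 1" using residue_eq_iff I_proper by auto
  then have "card {residue 0, residue 1} = 2" by simp
  moreover have "card {residue 0, residue 1} \<le> card (residue ` R)"
    using assms closed by (intro card_mono) auto
  ultimately show ?thesis by simp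
qed

text \<open>Modulo a monic \<open>p\<close> of degree \<open>d\<close>, the polynomials of degree less than \<open>d\<close> represent \<open>Q\<^sup>d\<close>
  residues, too many to be roots of \<open>X\<^sup>q - X\<close> for \<open>q < Q\<^sup>d\<close>.\<close>
lemma not_all_fixed_by_small_power:
  assumes fin: "finite (residue ` R)" and p: "p \<in> polys_over R" "lead_coeff p = 1"
    and I: "subring_prime_ideal (polys_over R) (multiples_mod p)"
    and q: "1 < q" "q < card (residue ` R) ^ degree p"
  shows "\<exists>A \<in> polys_over R. A ^ q - A \<notin> multiples_mod p"
proof (rule ccontr)
  assume "\<not> ?thesis"
  then have all: "A ^ q - A \<in> multiples_mod p" if "A \<in> polys_over R" for A using that by blast
  interpret J: subring_prime_ideal "polys_over R" "multiples_mod p" by (rule I)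
  define N where "N = degree p"
  have "\<exists>B \<subseteq> R. inj_on residue B \<and> residue ` R = residue ` B"
    by (rule subset_image_inj[THEN iffD1]) simp
  then obtain B where B: "B \<subseteq> R" "inj_on residue B" "residue ` R = residue ` B" by auto
  have cardB: "card B = card (residue ` R)" using B by (simp add: card_image)
  have finB: "finite B" using B fin by (simp add: finite_image_iff)
  define G where "G c = Poly (map c [0..<N])" for c :: "nat \<Rightarrow> 'f"
  have coeff_G: "coeff (G c) i = (if i < N then c i else 0)" for c i
    by (simp add: G_def coeff_Poly_eq nth_default_def)
  let ?E = "PiE {..<N} (\<lambda>_. B)"
  have inj: "c = c'" if cc: "c \<in> ?E" "c' \<in> ?E" "G c - G c' \<in> multiples_mod p" for c c'
  proof -
    have deg: "degree (G c - G c') < N \<or> G c = G c'"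
    proof (cases "N = 0")
      case False
      have "degree (G c - G c') \<le> N - 1" using False by (intro degree_le) (auto simp: coeff_G)
      with False have "degree (G c - G c') < N" by linarith
      then show ?thesis ..
    qed (simp add: G_def)
    have "G c - G c' \<in> polys_over P"
    proof (cases "G c = G c'")
      case True
      then show ?thesis by (simp add: polys_over_def I_0)
    next
      case False
      with deg cc(3) polys_over_P_if_multiple[OF p] show ?thesis by (auto simp: multiples_mod_def N_def)
    qed
    then have d: "coeff (G c - G c') i \<in> P" for i by (simp add: polys_over_def)
    have "c i = c' i" if i: "i < N" for i
    proof -
      have "c i - c' i \<in> P" using d[of i] i by (simp add: coeff_G)
      then have "residue (c i) = residue (c' i)" by (simp add: residue_eq_iff)
      moreover have "c i \<in> B" "c' i \<in> B" using cc i by auto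
      ultimately show ?thesis using B(2) by (simp add: inj_on_def)
    qed
    with cc(1,2) show ?thesis by (intro PiE_ext[of c _ _ c']) auto
  qed
  have inj_G: "inj_on G ?E" using inj J.I_0 by (auto simp: inj_on_def)
  have inj_res: "inj_on J.residue (G ` ?E)" using inj J.residue_eq_iff by (auto simp: inj_on_def)
  have card_T: "card (G ` ?E) = card (residue ` R) ^ N"
    using card_image[OF inj_G] by (simp add: card_PiE cardB)
  have T_S: "G ` ?E \<subseteq> polys_over R"
    using subsetD[OF B(1)] closed(1) by (auto simp: polys_over_def coeff_G PiE_def Pi_def)
  let ?h = "Polynomial.monom 1 q - Polynomial.monom 1 1 :: 'f poly poly"
  have "finite (G ` ?E) \<and> card (G ` ?E) \<le> degree ?h"
  proof (rule J.card_incongruent_roots[OF _ _ T_S _ inj_res])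
    show "?h \<in> polys_over (polys_over R)"
      using J.closed by (auto simp: polys_over_def[of "polys_over R"])
    show "\<exists>i. coeff ?h i \<notin> multiples_mod p" using q(1) J.I_proper by (intro exI[of _ q]) simp
    show "poly ?h A \<in> multiples_mod p" if "A \<in> G ` ?E" for A
      using all[of A] that T_S by (auto simp: poly_monom)
  qed
  moreover have "degree ?h \<le> q" using q(1) by (intro degree_diff_le) (auto simp: degree_monom_le intro: order_trans[OF degree_monom_le])
  ultimately show False using q(2) card_T by (simp add: N_def)
qed

text \<open>
  If the reduction were irreducible, then \<open>x - \<gamma>\<close> would generate a field of
  degree \<open>2\<^bsup>n\<^esup>\<close> over the residue field. Then the last critical value
  could not be a square of the residue field, but it is \<open>m\<^bsup>2^(n-1)\<^esup>\<close>.
\<close>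
lemma reduce_iterate_reducible:
  assumes fin: "finite (residue ` R)" and char: "odd CHAR('f)" and m: "m \<in> R" and n: "n \<ge> 2"
  defines "\<gamma> \<equiv> m ^ 2 ^ (n - 1) - crit_orbit m n"
  defines "p \<equiv> pcompose (poly_iterate (quad m) n) [:-\<gamma>, 1:] + [:\<gamma>:]"
  shows "reducible_in (poly_ring K) (reduce_poly R P p)"
proof -
  let ?S = "polys_over R"
  have SR: "subring ?S ring_of_type_algebra" by (rule subring_polys_over[OF S])
  note pc = subring_of_type[OF SR]
  define u where "u i = pcompose (poly_iterate (quad m) i) [:-\<gamma>, 1:]" for i
  have u0: "u 0 = [:-\<gamma>, 1:]" by (simp add: u_def pcompose_pCons)
  have u_Suc: "u (Suc i) = (u i)\<^sup>2 + [:m:]" for i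
    by (simp add: u_def poly_iterate_quad_Suc pcompose_add power2_eq_square pcompose_mult)
  have p_eq: "p = u n + [:\<gamma>:]" by (simp add: p_def u_def)
  have crit_R: "crit_orbit m i \<in> R" for i
    by (induction i) (auto simp: crit_orbit_Suc m closed)
  have \<gamma>: "\<gamma> \<in> R" using crit_R m closed by (auto simp: \<gamma>_def)
  have const: "[:c:] \<in> ?S" if "c \<in> R" for c
    using that polys_over_pCons[OF S, of c 0] polys_over_0[OF S] by simp
  have u0_S: "u 0 \<in> ?S" using \<gamma> closed polys_over_pCons[OF S] polys_over_0[OF S] by (simp add: u0)
  have "u i \<in> ?S" for i by (induction i) (auto simp: u0_S u_Suc const m intro!: pc)
  then have p_S: "p \<in> ?S" using const[OF \<gamma>] pc(4) by (simp add: p_eq)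
  have deg_u: "degree (u n) = 2 ^ n" by (simp add: u_def degree_pcompose)
  have deg_p: "degree p = 2 ^ n" unfolding p_eq by (subst degree_add_eq_left) (simp_all add: deg_u)
  have "lead_coeff (u n) = 1"
    unfolding u_def by (subst lead_coeff_comp) (simp_all only: lead_coeff_poly_iterate_quad, simp_all)
  moreover have "coeff [:\<gamma>:] (2 ^ n) = 0" by (rule coeff_eq_0) simp
  ultimately have lead_p: "lead_coeff p = 1" unfolding deg_p by (simp add: p_eq deg_u)
  have not_irr: "\<not> ring_irreducible\<^bsub>poly_ring K\<^esub> (reduce_poly R P p)"
  proof
    assume irr: "ring_irreducible\<^bsub>poly_ring K\<^esub> (reduce_poly R P p)"
    define Q where "Q = card (residue ` R)"
    have Q_gt: "1 < Q" unfolding Q_def by (rule card_K_gt_1[OF fin])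
    have prime_char: "Factorial_Ring.prime CHAR('f)" using char by (intro prime_CHAR_semidom) (simp add: odd_pos)
    obtain r where r: "Q = CHAR('f) ^ r" unfolding Q_def using card_K_prime_power[OF fin prime_char] .
    have I: "subring_prime_ideal ?S (multiples_mod p)"
      by (rule subring_prime_ideal_multiples_mod[OF p_S irr])
    interpret J: subring_prime_ideal ?S "multiples_mod p" by (rule I)
    have P_I: "polys_over P \<subseteq> multiples_mod p"
    proof
      fix A assume A: "A \<in> polys_over P"
      then have "A \<in> ?S" using I_subset by (auto simp: polys_over_def)
      then show "A \<in> multiples_mod p"
        unfolding multiples_mod_def using A pc(1) by (intro CollectI conjI bexI[of _ 0]) auto
    qed
    have const_fixed: "J.cong ([:c:] ^ Q) [:c:]" if "c \<in> R" for c
    proof -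
      have "[:c ^ Q - c:] \<in> polys_over P"
        using power_card_K[OF fin that] I_0 by (auto simp: Q_def polys_over_def coeff_pCons split: nat.splits)
      then show ?thesis using P_I by (auto simp: J.cong_def poly_const_pow)
    qed
    interpret T: frobenius_tower ?S "multiples_mod p" Q n "[:m:]" "[:\<gamma>:]" u "\<lambda>i. [:crit_orbit m i:]"
    proof
      show "odd Q" using char by (simp add: r)
      show "(x + y) ^ Q = x ^ Q + y ^ Q" for x y :: "'f poly"
        using prime_char by (intro freshmans_dream'[of _ r]) (simp_all add: r)
      show "2 \<notin> multiples_mod p"
      proof
        assume "2 \<in> multiples_mod p"
        then have "of_nat (Suc CHAR('f poly) div 2) * 2 \<in> multiples_mod p"
          by (intro J.I_mult of_nat_in_subring[OF SR])
        moreover have "odd CHAR('f poly)" using char by simp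
        from half_in_odd_char[OF this] have "of_nat (Suc CHAR('f poly) div 2) * 2 = (1 :: 'f poly)"
          by (simp only: mult.commute)
        ultimately show False using J.I_proper by metis
      qed
      show "u n + [:\<gamma>:] \<in> multiples_mod p"
        unfolding multiples_mod_def using p_S pc(2) I_0
        by (intro CollectI conjI bexI[of _ 1]) (auto simp: p_eq polys_over_def)
      show "[:crit_orbit m (Suc i):] = [:crit_orbit m i:]\<^sup>2 + [:m:]" for i
        by (simp add: crit_orbit_Suc power2_eq_square)
    qed (use const m \<gamma> const_fixed u0_S u_Suc n in auto)
    interpret T: frobenius_tower_of_full_degree ?S "multiples_mod p" Q n "[:m:]" "[:\<gamma>:]" u "\<lambda>i. [:crit_orbit m i:]"
    proof
      define l where "l = (2::nat) ^ (n - 1)"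
      show "\<not> J.cong (u 0 ^ Q ^ 2 ^ (n - 1)) (u 0)"
      proof
        assume *: "J.cong (u 0 ^ Q ^ 2 ^ (n - 1)) (u 0)"
        have x_eq: "[:0, 1:] = u 0 + [:\<gamma>:]" by (simp add: u0)
        have "J.cong ([:0, 1:] ^ (Q ^ l)) [:0, 1:]"
          unfolding x_eq T.frob_power_add using * T.frob_power_fixed[OF const const_fixed] \<gamma>
          by (intro J.cong_add) (auto simp: l_def)
        have x_S: "[:0, 1:] \<in> ?S" unfolding x_eq using pc(4) u0_S const \<gamma> by blast
        have "J.cong (A ^ (Q ^ l)) A" if "A \<in> ?S" for A
          using that
        proof (induction A)
          case 0
          have "0 < Q ^ l" using Q_gt by simp
          then show ?case by (simp only: zero_power J.cong_refl)
        next
          case (pCons c A)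
          then have c: "c \<in> R" "A \<in> ?S" using polys_over_pCons[OF S] by auto
          have eq: "pCons c A = [:c:] + [:0, 1:] * A" by simp
          have "J.cong (([:0, 1:] * A) ^ (Q ^ l)) ([:0, 1:] * A)"
            unfolding power_mult_distrib using \<open>J.cong ([:0, 1:] ^ (Q ^ l)) [:0, 1:]\<close> pCons.IH[OF c(2)] c(2) x_S pc
            by (intro J.cong_mult) auto
          then show ?case
            unfolding eq T.frob_power_add
            using T.frob_power_fixed[OF const const_fixed] c(1) by (intro J.cong_add) auto
        qed
        moreover have "1 < Q ^ l" using Q_gt by (intro one_less_power) (simp_all add: l_def)
        moreover have "Q ^ l < Q ^ degree p"
          using Q_gt n unfolding deg_p l_def by (intro power_strict_increasing) auto
        ultimately show False
          using not_all_fixed_by_small_power[OF fin p_S lead_p I, of "Q ^ l"]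
          by (auto simp: J.cong_def Q_def)
      qed
    qed
    define c where "c = m ^ 2 ^ (n - 2)"
    have "n - 1 = Suc (n - 2)" using n by simp
    then have "c\<^sup>2 = m ^ 2 ^ (n - 1)" by (simp add: c_def power_mult[symmetric] mult.commute)
    then have "[:crit_orbit m n:] + [:\<gamma>:] = [:c:]\<^sup>2" by (simp add: \<gamma>_def power2_eq_square)
    moreover have "c \<in> R" using m closed by (simp add: c_def)
    ultimately show False
      using T.final_critical_value_nonsquare[OF const const_fixed] J.cong_refl by metis
  qed
  have lead: "K.coeff (reduce_poly R P p) (2 ^ n) \<noteq> \<zero>\<^bsub>K\<^esub>"
    using lead_p K.one_not_zero by (simp add: coeff_reduce deg_p residue_one)
  show ?thesis
    unfolding reducible_in_def
  proof (intro conjI)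
    show "reduce_poly R P p \<in> carrier (poly_ring K)" by (rule reduce_in_carrier[OF p_S])
    show "reduce_poly R P p \<noteq> \<zero>\<^bsub>poly_ring K\<^esub>" using lead by (auto simp: univ_poly_zero)
    show "reduce_poly R P p \<notin> Units (poly_ring K)"
      using lead n by (auto simp: K.univ_poly_carrier_units split: if_splits)
    show "\<not> ring_irreducible\<^bsub>poly_ring K\<^esub> (reduce_poly R P p)" by (rule not_irr)
  qed
qed

end

section \<open>Irreducible iterates that are reducible modulo every prime\<close>

theorem theorem5p1:
  fixes F :: "'f::field ring"
    and k \<O> :: "'f set" and t m \<gamma> :: 'f
    and R\<^sub>1 Q\<^sub>1 R\<^sub>2 Q\<^sub>2 :: "'f set"
    and n :: nat and f\<^sub>0 f :: "'f poly"
  assumes F: "F = ring_of_type_algebra"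
    and function_field: "function_field F k t"
    and finite_k: "finite k"
    and odd_char: "odd CHAR('f)"
    and \<O>: "\<O> = integral_closure F (ring.simple_extension F k t)"
    and Q\<^sub>1: "prime_of F k R\<^sub>1 Q\<^sub>1" "valuation F R\<^sub>1 Q\<^sub>1 m > 0" "odd (valuation F R\<^sub>1 Q\<^sub>1 m)"
    and Q\<^sub>2: "prime_of F k R\<^sub>2 Q\<^sub>2" "valuation F R\<^sub>2 Q\<^sub>2 m < 0" "odd (valuation F R\<^sub>2 Q\<^sub>2 m)"
    and n: "n \<ge> 3"
    and f\<^sub>0: "f\<^sub>0 = [:0, 1:] ^ 2 + [:m:]"
    and \<gamma>: "\<gamma> = m ^ (2 ^ (n - 1)) - poly (poly_iterate f\<^sub>0 n) 0"
    and f: "f = ([:0, 1:] - [:\<gamma>:]) ^ 2 + [:\<gamma> + m:]"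
  shows "irreducible (poly_iterate f n) \<and>
    (\<forall>R P. prime_of F k R P \<and> valuation F R P m \<ge> 0 \<longrightarrow>
       reducible_in (poly_ring (residue_ring_at F R P)) (reduce_poly R P (poly_iterate f n)))"
proof (intro conjI allI impI)
  have quad: "f\<^sub>0 = quad m" by (simp add: f\<^sub>0 power2_eq_square)
  have \<gamma>_eq: "\<gamma> = m ^ 2 ^ (n - 1) - crit_orbit m n" by (simp add: \<gamma> quad)
  have iter: "poly_iterate f n = pcompose (poly_iterate (quad m) n) [:-\<gamma>, 1:] + [:\<gamma>:]"
    unfolding f by (rule poly_iterate_conjugate)
  have half: "2 * of_nat (Suc CHAR('f) div 2) = (1::'f)" using odd_char by (rule half_in_odd_char)
  then have two: "(2::'f) \<noteq> 0" by force
  have two_unit: "valuation F R P 2 = 0" if prime: "prime_of F k R P" for R P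
  proof -
    let ?v = "valuation ring_of_type_algebra R P"
    have prime': "prime_of ring_of_type_algebra k R P" using prime by (simp add: F)
    interpret v: valued_field ?v by (rule prime_valuation(1)[OF prime'])
    have "subring R (ring_of_type_algebra :: 'f ring)" using prime' by (simp add: prime_of_def)
    then have nonneg: "0 \<le> ?v (of_nat j)" for j using of_nat_in_subring prime_valuation(2)[OF prime'] by blast
    moreover have "of_nat (Suc CHAR('f) div 2) \<noteq> (0::'f)" using half by force
    then have "?v 2 + ?v (of_nat (Suc CHAR('f) div 2)) = 0"
      using v.mult[of 2 "of_nat (Suc CHAR('f) div 2)"] half two by simp
    moreover have "0 \<le> ?v 2" using nonneg[of 2] by simp
    ultimately show ?thesis using nonneg[of "Suc CHAR('f) div 2"] unfolding F by linarith
  qed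
  have m0: "m \<noteq> 0" using Q\<^sub>1(2) by (auto simp: valuation_def F)
  have "irreducible (poly_iterate (quad m) n + [:\<gamma>:])"
    unfolding \<gamma>_eq
    using prime_valuation(1)[of k] Q\<^sub>1 Q\<^sub>2 two_unit
    by (intro irreducible_iterate[of "valuation F R\<^sub>1 Q\<^sub>1" _ "valuation F R\<^sub>2 Q\<^sub>2"] m0 two n)
       (auto simp: F)
  from irreducible_pcompose_linear[OF this, of "-\<gamma>"] show "irreducible (poly_iterate f n)"
    by (simp add: iter pcompose_add)
  fix R P assume RP: "prime_of F k R P \<and> valuation F R P m \<ge> 0"
  interpret residue_field_of_prime k R P
    by standard (use RP in \<open>simp add: F\<close>)
  have "finite (residue ` R)"
    using finite_residue_field[OF _ finite_k prime] function_field by (simp add: F)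
  moreover have "m \<in> R" using prime_valuation(2)[OF prime] RP by (simp add: F)
  ultimately show "reducible_in (poly_ring (residue_ring_at F R P)) (reduce_poly R P (poly_iterate f n))"
    using reduce_iterate_reducible[of m n] odd_char n unfolding iter F \<gamma>_eq by simp
qed

end
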